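(* Let $G$ be a definable group in a sufficiently saturated structure $\mathbb U$, equipped with a left-translation invariant, indiscernibly prime ideal $\mathcal I$ on the boolean algebra of all definable subsets of $G$, type-definable over $\emptyset$. Let $M\preceq\mathbb U$ and let $A\subseteq G$ be a wide set definable over $M$. If no wide complete type over $M$ containing $A$ is product-free, then $A(M)$ contains an IP set.
   Context: An ideal $\mathcal I$ of definable sets is indiscernibly prime if whenever $(b_i)_{i\in\mathbb N}$ is indiscernible and $\varphi(x,b_1)\wedge\varphi(x,b_2)\in\mathcal I$, then $\varphi(x,b_1)\in\mathcal I$; type-definable over $\emptyset$ means for every formula $\varphi(x,y)$ there is a partial type $\Sigma_\varphi(y)$ over $\emptyset$ with $\Sigma_\varphi(b)\iff\varphi(x,b)\in\mathcal I$. A partial type is wide if it contains no definable set in $\mathcal I$. A type $p$ is product-free if $p\cup(p^{-1}\cdot p)$ is inconsistent (no realization of $p$ is of the form $b\cdot c$ with $b,c\models p$). A subset $S$ of a group is an IP set if there is an enumeration $(x_i)_{i\in\mathbb N}$ of an infinite subset of $S$ (pairwise distinct) such that $S$ contains all finite ordered products $x_{i_1}\cdots x_{i_k}$ with $i_1<\dots<i_k$, $k\ge1$.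
   Formalization: The group G is additionally assumed infinite (for G = {e} with ideal {∅} and A = G the claim fails, since an IP set is infinite), and "definable group" is read as definable over ∅. *)

theory Defs
  imports Main "HOL-Algebra.Group"
begin

text \<open>Formulas over a relational signature with relation symbols of type 'r.
  A relation symbol is applied to a list of variables; its interpretation is a set of
  lists of elements (so a symbol may carry relations of several arities).
  Variables are natural numbers.\<close>

datatype 'r fm =
    Eq nat nat
  | Rel 'r "nat list"
  | Neg "'r fm"
  | Conj "'r fm" "'r fm"
  | Ex nat "'r fm"

fun fv :: "'r fm \<Rightarrow> nat set" where
  "fv (Eq i j) = {i, j}"
| "fv (Rel r xs) = set xs"
| "fv (Neg \<phi>) = fv \<phi>"
| "fv (Conj \<phi> \<psi>) = fv \<phi> \<union> fv \<psi>"
| "fv (Ex x \<phi>) = fv \<phi> - {x}"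

type_synonym ('a, 'r) struct = "'a set \<times> ('r \<Rightarrow> 'a list set)"

fun sat :: "('a, 'r) struct \<Rightarrow> (nat \<Rightarrow> 'a) \<Rightarrow> 'r fm \<Rightarrow> bool" where
  "sat S e (Eq i j) = (e i = e j)"
| "sat S e (Rel r xs) = (map e xs \<in> snd S r)"
| "sat S e (Neg \<phi>) = (\<not> sat S e \<phi>)"
| "sat S e (Conj \<phi> \<psi>) = (sat S e \<phi> \<and> sat S e \<psi>)"
| "sat S e (Ex x \<phi>) = (\<exists>a\<in>fst S. sat S (e(x := a)) \<phi>)"

definition is_structure :: "('a, 'r) struct \<Rightarrow> bool" where
  "is_structure S \<longleftrightarrow> fst S \<noteq> {} \<and> (\<forall>r. \<forall>xs\<in>snd S r. set xs \<subseteq> fst S)"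

definition restr :: "('a, 'r) struct \<Rightarrow> 'a set \<Rightarrow> ('a, 'r) struct" where
  "restr U M = (M, \<lambda>r. {xs \<in> snd U r. set xs \<subseteq> M})"

definition elem_sub :: "'a set \<Rightarrow> ('a, 'r) struct \<Rightarrow> bool" where
  "elem_sub M U \<longleftrightarrow> M \<noteq> {} \<and> M \<subseteq> fst U \<and>
     (\<forall>\<phi> e. (\<forall>i. e i \<in> M) \<longrightarrow> (sat (restr U M) e \<phi> \<longleftrightarrow> sat U e \<phi>))"

text \<open>Formulas in the object variables 0..n-1 with parameters from B: a pair (phi, bs)
  where variable n+j refers to the parameter bs!j.\<close>
definition fmls_over :: "'a set \<Rightarrow> nat \<Rightarrow> ('r fm \<times> 'a list) set" where
  "fmls_over B n = {(\<phi>, bs). set bs \<subseteq> B \<and> fv \<phi> \<subseteq> {..<n + length bs}}"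

definition tuples :: "('a, 'r) struct \<Rightarrow> nat \<Rightarrow> 'a list set" where
  "tuples U n = {a. length a = n \<and> set a \<subseteq> fst U}"

definition defset :: "('a, 'r) struct \<Rightarrow> nat \<Rightarrow> 'r fm \<Rightarrow> 'a list \<Rightarrow> 'a list set" where
  "defset U n \<phi> bs = {a \<in> tuples U n. sat U (nth (a @ bs)) \<phi>}"

definition definable_over :: "('a, 'r) struct \<Rightarrow> nat \<Rightarrow> 'a set \<Rightarrow> 'a list set \<Rightarrow> bool" where
  "definable_over U n B X \<longleftrightarrow> (\<exists>(\<phi>, bs)\<in>fmls_over B n. X = defset U n \<phi> bs)"

definition realizes :: "('a, 'r) struct \<Rightarrow> nat \<Rightarrow> 'a list \<Rightarrow> ('r fm \<times> 'a list) set \<Rightarrow> bool" where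
  "realizes U n a p \<longleftrightarrow> a \<in> tuples U n \<and> (\<forall>(\<phi>, bs)\<in>p. sat U (nth (a @ bs)) \<phi>)"

definition fin_sat :: "('a, 'r) struct \<Rightarrow> nat \<Rightarrow> ('r fm \<times> 'a list) set \<Rightarrow> bool" where
  "fin_sat U n p \<longleftrightarrow> (\<forall>q \<subseteq> p. finite q \<longrightarrow> (\<exists>a. realizes U n a q))"

definition complete_type :: "('a, 'r) struct \<Rightarrow> 'a set \<Rightarrow> nat \<Rightarrow> ('r fm \<times> 'a list) set \<Rightarrow> bool" where
  "complete_type U B n p \<longleftrightarrow> p \<subseteq> fmls_over B n \<and> fin_sat U n p \<and>
     (\<forall>(\<phi>, bs)\<in>fmls_over B n. (\<phi>, bs) \<in> p \<or> (Neg \<phi>, bs) \<in> p)"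

text \<open>U is kappa-saturated for kappa = (2^(|M|+|L|+aleph_0))^+ : every finitely satisfiable
  set of formulas over a parameter set of size at most 2^(|M|+|L|+aleph_0) is realized.\<close>
definition saturated_over :: "('a, 'r) struct \<Rightarrow> 'a set \<Rightarrow> bool" where
  "saturated_over U M \<longleftrightarrow>
     (\<forall>B n p. B \<subseteq> fst U \<longrightarrow>
        (card_of B, card_of (Pow (M <+> (UNIV :: 'r set) <+> (UNIV :: nat set)))) \<in> ordLeq \<longrightarrow>
        p \<subseteq> fmls_over B n \<longrightarrow> fin_sat U n p \<longrightarrow> (\<exists>a. realizes U n a p))"

definition indiscernible :: "('a, 'r) struct \<Rightarrow> nat \<Rightarrow> (nat \<Rightarrow> 'a list) \<Rightarrow> bool" where
  "indiscernible U m b \<longleftrightarrow> (\<forall>i. b i \<in> tuples U m) \<and>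
     (\<forall>\<psi> is js. length is = length js \<longrightarrow> sorted_wrt (<) is \<longrightarrow> sorted_wrt (<) js \<longrightarrow>
        fv \<psi> \<subseteq> {..<m * length is} \<longrightarrow>
        (sat U (nth (concat (map b is))) \<psi> \<longleftrightarrow> sat U (nth (concat (map b js))) \<psi>))"

definition definable_group :: "('a, 'r) struct \<Rightarrow> nat \<Rightarrow> 'a list monoid \<Rightarrow> bool" where
  "definable_group U n Gr \<longleftrightarrow> group Gr \<and> carrier Gr \<subseteq> tuples U n \<and>
     definable_over U n {} (carrier Gr) \<and>
     definable_over U (3 * n) {}
        {x @ y @ z | x y z. x \<in> carrier Gr \<and> y \<in> carrier Gr \<and> z = x \<otimes>\<^bsub>Gr\<^esub> y}"

definition def_subsets :: "('a, 'r) struct \<Rightarrow> nat \<Rightarrow> 'a list monoid \<Rightarrow> 'a list set set" where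
  "def_subsets U n Gr = {X. X \<subseteq> carrier Gr \<and> definable_over U n (fst U) X}"

definition is_ideal :: "('a, 'r) struct \<Rightarrow> nat \<Rightarrow> 'a list monoid \<Rightarrow> 'a list set set \<Rightarrow> bool" where
  "is_ideal U n Gr I \<longleftrightarrow> I \<subseteq> def_subsets U n Gr \<and> {} \<in> I \<and>
     (\<forall>X\<in>I. \<forall>Y\<in>def_subsets U n Gr. Y \<subseteq> X \<longrightarrow> Y \<in> I) \<and>
     (\<forall>X\<in>I. \<forall>Y\<in>I. X \<union> Y \<in> I)"

definition left_invariant :: "'a list monoid \<Rightarrow> 'a list set set \<Rightarrow> bool" where
  "left_invariant Gr I \<longleftrightarrow> (\<forall>X\<in>I. \<forall>g\<in>carrier Gr. (\<lambda>x. g \<otimes>\<^bsub>Gr\<^esub> x) ` X \<in> I)"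

definition inst :: "('a, 'r) struct \<Rightarrow> nat \<Rightarrow> 'a list monoid \<Rightarrow> 'r fm \<Rightarrow> 'a list \<Rightarrow> 'a list set" where
  "inst U n Gr \<phi> b = defset U n \<phi> b \<inter> carrier Gr"

definition indiscernibly_prime ::
  "('a, 'r) struct \<Rightarrow> nat \<Rightarrow> 'a list monoid \<Rightarrow> 'a list set set \<Rightarrow> bool" where
  "indiscernibly_prime U n Gr I \<longleftrightarrow>
     (\<forall>m \<phi> b. fv \<phi> \<subseteq> {..<n + m} \<longrightarrow> indiscernible U m b \<longrightarrow>
        inst U n Gr \<phi> (b 0) \<inter> inst U n Gr \<phi> (b 1) \<in> I \<longrightarrow> inst U n Gr \<phi> (b 0) \<in> I)"

definition type_definable_empty ::
  "('a, 'r) struct \<Rightarrow> nat \<Rightarrow> 'a list monoid \<Rightarrow> 'a list set set \<Rightarrow> bool" where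
  "type_definable_empty U n Gr I \<longleftrightarrow>
     (\<forall>m \<phi>. fv \<phi> \<subseteq> {..<n + m} \<longrightarrow>
        (\<exists>\<Sigma>. (\<forall>\<sigma>\<in>\<Sigma>. fv \<sigma> \<subseteq> {..<m}) \<and>
             (\<forall>b\<in>tuples U m. (\<forall>\<sigma>\<in>\<Sigma>. sat U (nth b) \<sigma>) \<longleftrightarrow> inst U n Gr \<phi> b \<in> I)))"

definition type_contains ::
  "('a, 'r) struct \<Rightarrow> nat \<Rightarrow> ('r fm \<times> 'a list) set \<Rightarrow> 'a list set \<Rightarrow> bool" where
  "type_contains U n p A \<longleftrightarrow> (\<exists>(\<phi>, bs)\<in>p. defset U n \<phi> bs = A)"

definition wide_type ::
  "('a, 'r) struct \<Rightarrow> nat \<Rightarrow> 'a list monoid \<Rightarrow> 'a list set set \<Rightarrow> ('r fm \<times> 'a list) set \<Rightarrow> bool" where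
  "wide_type U n Gr I p \<longleftrightarrow> (\<forall>(\<phi>, bs)\<in>p. inst U n Gr \<phi> bs \<notin> I)"

definition product_free ::
  "('a, 'r) struct \<Rightarrow> nat \<Rightarrow> 'a list monoid \<Rightarrow> ('r fm \<times> 'a list) set \<Rightarrow> bool" where
  "product_free U n Gr p \<longleftrightarrow>
     \<not> (\<exists>a b c. realizes U n a p \<and> realizes U n b p \<and> realizes U n c p \<and>
          b \<in> carrier Gr \<and> c \<in> carrier Gr \<and> a = b \<otimes>\<^bsub>Gr\<^esub> c)"

fun gprod :: "'a list monoid \<Rightarrow> 'a list list \<Rightarrow> 'a list" where
  "gprod Gr [] = \<one>\<^bsub>Gr\<^esub>"
| "gprod Gr [x] = x"
| "gprod Gr (x # xs) = x \<otimes>\<^bsub>Gr\<^esub> gprod Gr xs"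

definition IP_set :: "'a list monoid \<Rightarrow> 'a list set \<Rightarrow> bool" where
  "IP_set Gr S \<longleftrightarrow> (\<exists>x :: nat \<Rightarrow> 'a list. inj x \<and> range x \<subseteq> S \<and>
     (\<forall>is. is \<noteq> [] \<longrightarrow> sorted_wrt (<) is \<longrightarrow> gprod Gr (map x is) \<in> S))"

end

(* Call sets in the ideal thin.  Fix a wide M-definable B such that no wide type over M through B is product-free.  The point is to find
   z in B(M) with B \<inter> z^-1 B wide; replacing B by this set (minus z) and iterating gives the IP set, as in
   the Galvin-Glazer proof of Hindman's theorem.  By type-definability of the ideal it suffices to find
   such a point e of B in U, since a formula witnessing wideness can be satisfied in M.

   Since the ideal is prime, the relation "gB \<inter> hB is thin" is stable.  Hence for e wide over M and x,
   whether xB \<inter> eB is thin depends only on the types of x and of e over M.  Take a wide type p through B,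
   realizations a = bc of p, and e realizing p wide over a, b, c.  By stationarity cB \<inter> eB
   behaves like two terms of a Morley sequence in p, so it is wide.  Translating by b, aB \<inter> beB is
   wide; be is wide over a and over b, and a, b have the same type, so bB \<inter> beB is wide,
   that is, B \<inter> eB is wide. *)

theory Submission
  imports Defs
begin

subsection \<open>Definable predicates\<close>

text \<open>Two ultrafilters carry the argument, because no single one does both jobs. A wide type
  over \<open>M\<close> extends to a global wide ultrafilter \<open>W\<close>, which supplies points
  wide over any small set but need not be invariant over \<open>M\<close>. A coheir \<open>V\<close>
  of the same type over \<open>M\<close> concentrates on points of \<open>M\<close>, so it is
  invariant and generates indiscernible sequences without any Ramsey argument, but it need not be
  wide. The two agree over \<open>M\<close> only. This is why the stationarity statement mixes a
  point \<open>e\<close>, wide over \<open>x\<close>, with a point \<open>d\<close>, generic for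
  \<open>V\<close> over \<open>e\<close>. Stability rests on primality: if thinness of the meet held
  on exactly one side of a half-graph, reversing the order would give an indiscernible sequence of
  wide sets with thin pairwise intersections. Discarding \<open>z\<close> in the iteration requires
  points to be thin, and this is where the infinity of \<open>G\<close> enters.\<close>

lemma finite_fv [simp]: "finite (fv \<phi>)"
  by (induction \<phi>) auto

lemma sat_cong: "(\<And>i. i \<in> fv \<phi> \<Longrightarrow> e i = e' i) \<Longrightarrow> sat S e \<phi> = sat S e' \<phi>"
proof (induction \<phi> arbitrary: e e')
  case (Rel r xs)
  then have "map e xs = map e' xs" by (intro map_cong) auto
  then show ?case by (simp del: map_eq_conv)
next
  case (Neg \<phi>)
  then show ?case by (metis fv.simps(3) sat.simps(3))
next
  case (Conj \<phi> \<psi>)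
  have "sat S e \<phi> = sat S e' \<phi>" "sat S e \<psi> = sat S e' \<psi>"
    using Conj.prems by (simp_all add: Conj.IH(1)[of e e'] Conj.IH(2)[of e e'])
  then show ?case by simp
next
  case (Ex x \<phi>)
  have "sat S (e(x := a)) \<phi> = sat S (e'(x := a)) \<phi>" for a
    using Ex.prems by (intro Ex.IH) auto
  then show ?case by simp
qed simp

text \<open>The variable map may be any function; bound variables are moved to a fresh index to avoid capture.\<close>
primrec ren :: "(nat \<Rightarrow> nat) \<Rightarrow> 'r fm \<Rightarrow> 'r fm" where
  "ren f (Eq i j) = Eq (f i) (f j)"
| "ren f (Rel r xs) = Rel r (map f xs)"
| "ren f (Neg \<phi>) = Neg (ren f \<phi>)"
| "ren f (Conj \<phi> \<psi>) = Conj (ren f \<phi>) (ren f \<psi>)"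
| "ren f (Ex x \<phi>) = (let z = Suc (Max (insert 0 (f ` fv \<phi>))) in Ex z (ren (f(x := z)) \<phi>))"

lemma fresh_notin: "v \<in> fv \<phi> \<Longrightarrow> f v \<noteq> Suc (Max (insert 0 (f ` fv \<phi>)))"
proof -
  assume "v \<in> fv \<phi>"
  then have "f v \<le> Max (insert 0 (f ` fv \<phi>))" by (intro Max_ge) auto
  then show ?thesis by linarith
qed

lemma fv_ren: "fv (ren f \<phi>) \<subseteq> f ` fv \<phi>"
proof (induction \<phi> arbitrary: f)
  case (Ex x \<phi>)
  let ?z = "Suc (Max (insert 0 (f ` fv \<phi>)))"
  have "fv (ren (f(x := ?z)) \<phi>) \<subseteq> f(x := ?z) ` fv \<phi>" by (rule Ex.IH)
  then show ?case by (auto simp: Let_def split: if_splits)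
next
  case (Conj \<phi> \<psi>)
  have "fv (ren f \<phi>) \<subseteq> f ` fv \<phi>" "fv (ren f \<psi>) \<subseteq> f ` fv \<psi>" by (rule Conj.IH)+
  then show ?case unfolding ren.simps fv.simps image_Un by blast
qed auto

lemma sat_ren: "sat S e (ren f \<phi>) = sat S (e \<circ> f) \<phi>"
proof (induction \<phi> arbitrary: e f)
  case (Ex x \<phi>)
  let ?z = "Suc (Max (insert 0 (f ` fv \<phi>)))"
  have "sat S (e(?z := a) \<circ> f(x := ?z)) \<phi> = sat S ((e \<circ> f)(x := a)) \<phi>" for a
    by (intro sat_cong) (auto dest: fresh_notin[of _ \<phi> f])
  then show ?case unfolding ren.simps Let_def sat.simps Ex.IH by simp
qed auto

primrec exs :: "nat \<Rightarrow> 'r fm \<Rightarrow> 'r fm" where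
  "exs 0 \<phi> = \<phi>"
| "exs (Suc k) \<phi> = Ex k (exs k \<phi>)"

lemma fv_exs: "fv (exs k \<phi>) = fv \<phi> - {..<k}"
  by (induction k) (auto simp: lessThan_Suc)

lemma sat_exs:
  "sat S e (exs k \<phi>) \<longleftrightarrow> (\<exists>a. length a = k \<and> set a \<subseteq> fst S \<and> sat S (\<lambda>i. if i < k then a ! i else e i) \<phi>)"
proof (induction k arbitrary: e)
  case 0
  then show ?case by simp
next
  case (Suc k)
  have eq: "(\<lambda>i. if i < k then a ! i else (e(k := b)) i) = (\<lambda>i. if i < Suc k then (a @ [b]) ! i else e i)"
    if "length a = k" for a b
    using that by (auto simp: nth_append less_Suc_eq)
  show ?case (is "_ \<longleftrightarrow> ?R")
  proof
    assume "sat S e (exs (Suc k) \<phi>)"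
    then obtain b a where "b \<in> fst S" "length a = k" "set a \<subseteq> fst S"
      "sat S (\<lambda>i. if i < k then a ! i else (e(k := b)) i) \<phi>"
      by (auto simp: Suc.IH)
    then show ?R unfolding eq[OF \<open>length a = k\<close>] by (intro exI[of _ "a @ [b]"]) auto
  next
    assume ?R
    then obtain a where a: "length a = Suc k" "set a \<subseteq> fst S"
      "sat S (\<lambda>i. if i < Suc k then a ! i else e i) \<phi>" by blast
    obtain a' b where ab: "a = a' @ [b]" using a(1) by (metis length_Suc_conv_rev)
    have l: "length a' = k" using a ab by simp
    have "sat S (\<lambda>i. if i < k then a' ! i else (e(k := b)) i) \<phi>"
      unfolding eq[OF l] using a(3) unfolding ab .
    moreover have "set a' \<subseteq> fst S" "b \<in> fst S" using a ab by auto
    ultimately show "sat S e (exs (Suc k) \<phi>)"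
      using l by (auto simp: Suc.IH simp del: fun_upd_apply)
  qed
qed

text \<open>The values of a definable predicate are constrained only on \<open>k\<close>-tuples from the structure.\<close>
definition dfn :: "('a, 'r) struct \<Rightarrow> 'a set \<Rightarrow> nat \<Rightarrow> ('a list \<Rightarrow> bool) \<Rightarrow> bool" where
  "dfn U C k P \<longleftrightarrow> (\<exists>(\<phi>, bs)\<in>fmls_over C k. \<forall>a\<in>tuples U k. P a \<longleftrightarrow> sat U (nth (a @ bs)) \<phi>)"

lemma dfnI:
  "fv \<phi> \<subseteq> {..<k + length bs} \<Longrightarrow> set bs \<subseteq> C \<Longrightarrow>
   (\<And>a. a \<in> tuples U k \<Longrightarrow> P a \<longleftrightarrow> sat U (nth (a @ bs)) \<phi>) \<Longrightarrow> dfn U C k P"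
  unfolding dfn_def fmls_over_def by blast

lemma dfnE:
  assumes "dfn U C k P"
  obtains \<phi> bs where "fv \<phi> \<subseteq> {..<k + length bs}" "set bs \<subseteq> C"
    "\<And>a. a \<in> tuples U k \<Longrightarrow> P a \<longleftrightarrow> sat U (nth (a @ bs)) \<phi>"
  using assms unfolding dfn_def fmls_over_def by blast

lemma dfn_cong: "dfn U C k P \<Longrightarrow> (\<And>a. a \<in> tuples U k \<Longrightarrow> P a = Q a) \<Longrightarrow> dfn U C k Q"
  unfolding dfn_def by auto

lemma dfn_mono: "dfn U C k P \<Longrightarrow> C \<subseteq> D \<Longrightarrow> dfn U D k P"
  unfolding dfn_def fmls_over_def by blast

lemma tuples_append: "x @ y \<in> tuples U (k + l) \<longleftrightarrow> x \<in> tuples U k \<and> y \<in> tuples U l"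
  if "length x = k \<or> length y = l"
  using that unfolding tuples_def by auto

lemma tuples_appendI: "x \<in> tuples U k \<Longrightarrow> y \<in> tuples U l \<Longrightarrow> x @ y \<in> tuples U (k + l)"
  unfolding tuples_def by auto

lemma tuplesD: "x \<in> tuples U k \<Longrightarrow> length x = k" "x \<in> tuples U k \<Longrightarrow> set x \<subseteq> fst U"
  unfolding tuples_def by auto

lemma sat_ren_nth:
  assumes "fv \<phi> \<subseteq> {..<length xs}" "length is = length xs"
    "\<And>i. i < length xs \<Longrightarrow> ys ! (is ! i) = xs ! i"
  shows "sat U (nth ys) (ren (nth is) \<phi>) = sat U (nth xs) \<phi>"
  unfolding sat_ren using assms by (intro sat_cong) auto

lemma fv_ren_nth:
  assumes "fv \<phi> \<subseteq> {..<length is}" "set is \<subseteq> {..<m}"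
  shows "fv (ren (nth is) \<phi>) \<subseteq> {..<m}"
proof
  fix v assume "v \<in> fv (ren (nth is) \<phi>)"
  then obtain i where "i \<in> fv \<phi>" "v = is ! i" using fv_ren[of "nth is" \<phi>] by blast
  then show "v \<in> {..<m}" using assms by (meson lessThan_iff nth_mem subsetD)
qed

lemma dfn_not: "dfn U C k P \<Longrightarrow> dfn U C k (\<lambda>a. \<not> P a)"
  by (erule dfnE, rule dfnI[where \<phi> = "Neg _"]) auto

lemma dfn_conj:
  assumes "dfn U C k P" "dfn U C k Q"
  shows "dfn U C k (\<lambda>a. P a \<and> Q a)"
proof -
  obtain \<phi> bs where 1: "fv \<phi> \<subseteq> {..<k + length bs}" "set bs \<subseteq> C"
    "\<And>a. a \<in> tuples U k \<Longrightarrow> P a \<longleftrightarrow> sat U (nth (a @ bs)) \<phi>" using assms(1) by (rule dfnE) blast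
  obtain \<psi> cs where 2: "fv \<psi> \<subseteq> {..<k + length cs}" "set cs \<subseteq> C"
    "\<And>a. a \<in> tuples U k \<Longrightarrow> Q a \<longleftrightarrow> sat U (nth (a @ cs)) \<psi>" using assms(2) by (rule dfnE) blast
  \<comment> \<open>The joint parameter list is \<open>bs @ cs\<close>, so the parameter variables
    of \<open>\<psi>\<close> skip over \<open>bs\<close>, while its object variables stay in
    place.\<close>
  let ?is = "[0..<k] @ [k + length bs..<k + length bs + length cs]"
  let ?\<chi> = "Conj \<phi> (ren (nth ?is) \<psi>)"
  have "fv (ren (nth ?is) \<psi>) \<subseteq> {..<k + length (bs @ cs)}"
    using 2(1) by (intro fv_ren_nth) auto
  then have fv: "fv ?\<chi> \<subseteq> {..<k + length (bs @ cs)}" using 1(1) by auto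
  show ?thesis
  proof (rule dfnI[OF fv])
    fix a assume a: "a \<in> tuples U k"
    have l: "length a = k" using a by (rule tuplesD)
    have "sat U (nth (a @ bs @ cs)) (ren (nth ?is) \<psi>) = sat U (nth (a @ cs)) \<psi>"
      using 2(1) l by (intro sat_ren_nth) (auto simp: nth_append)
    moreover have "sat U (nth (a @ bs @ cs)) \<phi> = sat U (nth (a @ bs)) \<phi>"
      using 1(1) l by (intro sat_cong) (auto simp: nth_append)
    ultimately show "(P a \<and> Q a) = sat U (nth (a @ bs @ cs)) ?\<chi>" using 1(3) 2(3) a by simp
  qed (use 1 2 in auto)
qed

lemma dfn_const: "c \<in> tuples U l \<Longrightarrow> set c \<subseteq> C \<Longrightarrow> dfn U C (k + l) P \<Longrightarrow> dfn U C k (\<lambda>a. P (a @ c))"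
proof -
  assume c: "c \<in> tuples U l" "set c \<subseteq> C" and "dfn U C (k + l) P"
  then obtain \<phi> bs where 1: "fv \<phi> \<subseteq> {..<k + l + length bs}" "set bs \<subseteq> C"
    "\<And>a. a \<in> tuples U (k + l) \<Longrightarrow> P a \<longleftrightarrow> sat U (nth (a @ bs)) \<phi>" by (elim dfnE) blast
  have "length c = l" using c by (auto dest: tuplesD)
  then show ?thesis using 1 c
    by (intro dfnI[of \<phi> k "c @ bs"]) (auto simp: tuples_appendI add.assoc)
qed

text \<open>Selections of coordinates, with repetition and omission allowed. The rearrangements of
  variable blocks used below are blocks \<open>take k (drop j a)\<close> glued by \<open>@\<close>,
  so one closure property covers them.\<close>

definition coord :: "nat \<Rightarrow> nat \<Rightarrow> ('a list \<Rightarrow> 'a list) \<Rightarrow> bool" where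
  "coord l k F \<longleftrightarrow> (\<exists>is. length is = k \<and> set is \<subseteq> {..<l} \<and> (\<forall>a. length a = l \<longrightarrow> F a = map (nth a) is))"

lemma coord_take_drop: "j + k \<le> l \<Longrightarrow> coord l k (\<lambda>a. take k (drop j a))"
  unfolding coord_def by (intro exI[of _ "[j..<j + k]"]) (auto intro: nth_equalityI)

lemma coord_append: "coord l k F \<Longrightarrow> coord l k' F' \<Longrightarrow> coord l (k + k') (\<lambda>a. F a @ F' a)"
  unfolding coord_def by (elim exE, rule_tac x = "is @ isa" in exI) auto

lemma dfn_coord:
  assumes "dfn U C k P" "coord l k F"
  shows "dfn U C l (\<lambda>a. P (F a))"
proof -
  obtain \<phi> bs where 1: "fv \<phi> \<subseteq> {..<k + length bs}" "set bs \<subseteq> C"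
    "\<And>a. a \<in> tuples U k \<Longrightarrow> P a \<longleftrightarrow> sat U (nth (a @ bs)) \<phi>" using assms(1) by (rule dfnE) blast
  obtain "is" where 2: "length is = k" "set is \<subseteq> {..<l}" "\<And>a. length a = l \<Longrightarrow> F a = map (nth a) is"
    using assms(2) unfolding coord_def by blast
  let ?js = "is @ [l..<l + length bs]"
  have "set ?js \<subseteq> {..<l + length bs}" using 2(2) by auto
  then have fv: "fv (ren (nth ?js) \<phi>) \<subseteq> {..<l + length bs}"
    using 1(1) 2 by (intro fv_ren_nth) auto
  show ?thesis
  proof (rule dfnI[OF fv 1(2)])
    fix a assume a: "a \<in> tuples U l"
    have l: "length a = l" using a by (rule tuplesD)
    have F: "F a = map (nth a) is" using 2(3) l by blast
    have "set (F a) \<subseteq> set a" unfolding F using 2(2) l by auto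
    then have t: "F a \<in> tuples U k" using a F 2(1) by (auto simp: tuples_def)
    have "sat U (nth (a @ bs)) (ren (nth ?js) \<phi>) = sat U (nth (F a @ bs)) \<phi>"
    proof (rule sat_ren_nth)
      fix i assume i: "i < length (F a @ bs)"
      have "i < k \<Longrightarrow> is ! i < l" using 2(1,2) by (meson lessThan_iff nth_mem subsetD)
      then show "(a @ bs) ! (?js ! i) = (F a @ bs) ! i"
        using i l 2(1) F by (auto simp: nth_append)
    qed (use 1(1) 2(1) F in auto)
    then show "P (F a) = sat U (nth (a @ bs)) (ren (nth ?js) \<phi>)" using 1(3) t by simp
  qed
qed

lemma dfn_ex:
  assumes "dfn U C (k + l) P"
  shows "dfn U C k (\<lambda>a. \<exists>u\<in>tuples U l. P (a @ u))"
proof -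
  obtain \<phi> bs where 1: "fv \<phi> \<subseteq> {..<k + l + length bs}" "set bs \<subseteq> C"
    "\<And>a. a \<in> tuples U (k + l) \<Longrightarrow> P a \<longleftrightarrow> sat U (nth (a @ bs)) \<phi>" using assms by (rule dfnE) blast
  \<comment> \<open>\<open>exs\<close> binds the variables below \<open>l\<close>, but the
    quantified block \<open>u\<close> stands behind \<open>a\<close>. So \<open>f\<close> exchanges
    the two blocks, and \<open>\<psi>\<close> shifts back down by \<open>l\<close>, which is safe
    because only variables from \<open>l\<close> on remain free.\<close>
  define f where "f i = (if i < k then i + l else if i < k + l then i - k else i)" for i
  define \<psi> where "\<psi> = ren (\<lambda>i. i - l) (exs l (ren f \<phi>))"
  have "fv (exs l (ren f \<phi>)) \<subseteq> {l..<k + l + length bs}"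
    using 1(1) fv_ren[of f \<phi>] by (fastforce simp: fv_exs f_def split: if_splits)
  then have fv: "fv \<psi> \<subseteq> {..<k + length bs}"
    unfolding \<psi>_def using fv_ren[of "\<lambda>i. i - l" "exs l (ren f \<phi>)"] by fastforce
  show ?thesis
  proof (rule dfnI[OF fv 1(2)])
    fix a assume a: "a \<in> tuples U k"
    have l: "length a = k" using a by (rule tuplesD)
    have "sat U (nth (a @ bs)) \<psi> \<longleftrightarrow> (\<exists>u. length u = l \<and> set u \<subseteq> fst U \<and>
      sat U ((\<lambda>i. if i < l then u ! i else (nth (a @ bs) \<circ> (\<lambda>i. i - l)) i) \<circ> f) \<phi>)" (is "_ \<longleftrightarrow> (\<exists>u. _ \<and> _ \<and> ?s u)")
      unfolding \<psi>_def sat_ren sat_exs ..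
    moreover have "?s u \<longleftrightarrow> P (a @ u)" if u: "length u = l" "set u \<subseteq> fst U" for u
    proof -
      have "?s u = sat U (nth ((a @ u) @ bs)) \<phi>"
        using 1(1) l u by (intro sat_cong) (auto simp: f_def nth_append add.commute)
      moreover have "a @ u \<in> tuples U (k + l)" using a u by (auto simp: tuples_def)
      ultimately show ?thesis using 1(3) by simp
    qed
    ultimately show "(\<exists>u\<in>tuples U l. P (a @ u)) = sat U (nth (a @ bs)) \<psi>"
      by (auto simp: tuples_def)
  qed
qed

text \<open>For \<open>k = 0\<close> there is no object variable to which \<open>Eq\<close> could be
  applied, so a bound one is used. Whether the resulting sentence or its negation is true depends on
  the universe being nonempty.\<close>

lemma dfn_True: "dfn U C k (\<lambda>_. True)"
proof -
  have "dfn U C k (\<lambda>_. \<exists>x\<in>tuples U 1. True)"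
    by (rule dfn_ex, rule dfnI[of "Eq k k" _ "[]"]) auto
  moreover have "dfn U C k (\<lambda>_. \<not> (\<exists>x\<in>tuples U 1. True))"
    by (rule dfn_not) fact
  ultimately show ?thesis by (cases "\<exists>x\<in>tuples U 1. True") simp_all
qed

lemma dfn_eq_tuple: "set c \<subseteq> C \<Longrightarrow> length c = k \<Longrightarrow> dfn U C k (\<lambda>a. a = c)"
proof (induction k arbitrary: c)
  case 0
  then show ?case by (intro dfn_cong[OF dfn_True]) (auto simp: tuples_def)
next
  case (Suc k)
  obtain c' b where c: "c = c' @ [b]" using Suc.prems by (metis length_Suc_conv_rev)
  have 1: "dfn U C (Suc k) (\<lambda>a. take k (drop 0 a) = c')"
    by (rule dfn_coord[OF Suc.IH coord_take_drop]) (use Suc.prems c in auto)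
  have 2: "dfn U C (Suc k) (\<lambda>a. a ! k = b)"
    by (rule dfnI[of "Eq k (Suc k)" _ "[b]"]) (use Suc.prems c in \<open>auto simp: nth_append tuples_def\<close>)
  show ?case
    by (rule dfn_cong[OF dfn_conj[OF 1 2]])
      (use Suc.prems c in \<open>auto simp: tuples_def length_Suc_conv_rev nth_append\<close>)
qed

lemma elem_sub_witness:
  assumes "elem_sub M U" "dfn U M k P" "a \<in> tuples U k" "P a"
  obtains z where "z \<in> tuples U k" "set z \<subseteq> M" "P z"
proof -
  obtain \<phi> bs where 1: "fv \<phi> \<subseteq> {..<k + length bs}" "set bs \<subseteq> M"
    "\<And>a. a \<in> tuples U k \<Longrightarrow> P a \<longleftrightarrow> sat U (nth (a @ bs)) \<phi>" using assms(2) by (rule dfnE) blast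
  obtain m0 where m0: "m0 \<in> M" using assms(1) unfolding elem_sub_def by blast
  have MU: "M \<subseteq> fst U" using assms(1) unfolding elem_sub_def by blast
  \<comment> \<open>Elementarity speaks of assignments with all values in \<open>M\<close>; the
    irrelevant variables therefore get the default \<open>m0\<close>.\<close>
  define e where "e i = (if k \<le> i \<and> i < k + length bs then bs ! (i - k) else m0)" for i
  have eM: "e i \<in> M" for i using 1(2) m0 unfolding e_def by auto
  have el: "sat (restr U M) e \<psi> = sat U e \<psi>" if "\<And>i. e i \<in> M" for e \<psi>
    using assms(1) that unfolding elem_sub_def by blast
  have key: "sat U (\<lambda>i. if i < k then z ! i else e i) \<phi> = sat U (nth (z @ bs)) \<phi>" if "length z = k" for z
    using 1(1) that by (intro sat_cong) (auto simp: e_def nth_append)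
  have "sat U e (exs k \<phi>)" unfolding sat_exs
    using assms(3,4) 1(3) key by (intro exI[of _ a]) (auto simp: tuples_def)
  then have "sat (restr U M) e (exs k \<phi>)" using el eM by blast
  then obtain z where z: "length z = k" "set z \<subseteq> M" "sat (restr U M) (\<lambda>i. if i < k then z ! i else e i) \<phi>"
    unfolding sat_exs by (auto simp: restr_def)
  have "(if i < k then z ! i else e i) \<in> M" for i using z(1,2) eM by auto
  then have "sat U (\<lambda>i. if i < k then z ! i else e i) \<phi>" using el[of "\<lambda>i. if i < k then z ! i else e i" \<phi>] z(3) by simp
  then have "sat U (nth (z @ bs)) \<phi>" using key z(1) by blast
  moreover have "z \<in> tuples U k" using z MU by (auto simp: tuples_def)
  ultimately show ?thesis using that 1(3) z by blast
qed

text \<open>Primality concerns formulas without parameters. Once exposed as a tuple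
  \<open>c\<close>, the parameters can be appended to every term of an indiscernible
  sequence.\<close>

lemma dfn_params:
  assumes "dfn U C k P"
  obtains c P' where "set c \<subseteq> C" "dfn U {} (k + length c) P'" "\<And>a. a \<in> tuples U k \<Longrightarrow> P a \<longleftrightarrow> P' (a @ c)"
proof -
  obtain \<phi> bs where 1: "fv \<phi> \<subseteq> {..<k + length bs}" "set bs \<subseteq> C"
    "\<And>a. a \<in> tuples U k \<Longrightarrow> P a \<longleftrightarrow> sat U (nth (a @ bs)) \<phi>" using assms by (rule dfnE) blast
  have "dfn U {} (k + length bs) (\<lambda>a. sat U (nth a) \<phi>)"
    by (rule dfnI[of \<phi> _ "[]"]) (use 1 in auto)
  then show ?thesis using 1 that by blast
qed

lemma dfn_const_left:
  assumes "c \<in> tuples U l" "set c \<subseteq> C" "dfn U C (l + k) P"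
  shows "dfn U C k (\<lambda>a. P (c @ a))"
proof -
  have "coord (k + l) (l + k) (\<lambda>a. take l (drop k a) @ take k (drop 0 a))"
    by (intro coord_append coord_take_drop) auto
  from dfn_coord[OF assms(3) this]
  have "dfn U C k (\<lambda>a. P (take l (drop k (a @ c)) @ take k (drop 0 (a @ c))))"
    by (rule dfn_const[OF assms(1,2)])
  then show ?thesis by (rule dfn_cong) (use assms(1) in \<open>auto dest!: tuplesD(1)\<close>)
qed

subsection \<open>Ultrafilters, types and Morley sequences\<close>

definition ultra :: "'b filter \<Rightarrow> bool" where
  "ultra W \<longleftrightarrow> W \<noteq> bot \<and> (\<forall>P. eventually P W \<or> eventually (\<lambda>x. \<not> P x) W)"

lemma ultra_not: "ultra W \<Longrightarrow> eventually (\<lambda>x. \<not> P x) W \<longleftrightarrow> \<not> eventually P W"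
proof -
  assume W: "ultra W"
  have "\<not> (eventually P W \<and> eventually (\<lambda>x. \<not> P x) W)"
  proof
    assume "eventually P W \<and> eventually (\<lambda>x. \<not> P x) W"
    then have "eventually P W" "eventually (\<lambda>x. \<not> P x) W" by blast+
    then have "eventually (\<lambda>x. False) W" by eventually_elim blast
    then show False using W by (simp add: ultra_def)
  qed
  then show ?thesis using W unfolding ultra_def by blast
qed

lemma ultra_happens: "ultra W \<Longrightarrow> eventually P W \<Longrightarrow> \<exists>x. P x"
  unfolding ultra_def using eventually_happens' by blast

lemma ultra_filtermap: "ultra W \<Longrightarrow> ultra (filtermap f W)"
  unfolding ultra_def by (auto simp: eventually_filtermap filtermap_bot_iff)

lemma ultra_le:
  fixes F0 :: "'b filter"
  assumes "F0 \<noteq> bot"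
  obtains W where "ultra W" "W \<le> F0"
proof -
  define S where "S = {E. E \<noteq> bot \<and> E \<le> F0}"
  \<comment> \<open>Finer filters are smaller, so ultrafilters are the minimal proper filters;
    Zorn's lemma is applied to the reversed order.\<close>
  let ?P = "\<lambda>E E' :: 'b filter. E' \<le> E"
  have "\<exists>m\<in>S. \<forall>a\<in>S. ?P m a \<longrightarrow> a = m"
  proof (rule predicate_Zorn)
    show "partial_order_on S (relation_of ?P S)"
      by (rule partial_order_on_relation_ofI) auto
  next
    fix C assume C: "C \<in> Chains (relation_of ?P S)"
    then have CS: "C \<subseteq> S" and lin: "\<And>E E'. E \<in> C \<Longrightarrow> E' \<in> C \<Longrightarrow> E \<le> E' \<or> E' \<le> E"
      unfolding Chains_def relation_of_def by blast+
    show "\<exists>u\<in>S. \<forall>a\<in>C. ?P a u"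
    proof (cases "C = {}")
      case True
      then show ?thesis using assms by (auto simp: S_def)
    next
      case False
      \<comment> \<open>A chain is a base of its infimum, so the infimum is improper only if some
        member is.\<close>
      have "eventually (\<lambda>_. False) (Inf C) \<longleftrightarrow> (\<exists>E\<in>C. eventually (\<lambda>_. False) E)"
      proof (rule eventually_Inf_base[OF False])
        fix E E' assume "E \<in> C" "E' \<in> C"
        then show "\<exists>x\<in>C. x \<le> inf E E'" using lin[of E E'] by (metis inf.absorb1 inf.absorb2 order_refl)
      qed
      then have "Inf C \<noteq> bot" using CS unfolding S_def by (auto simp: trivial_limit_def)
      moreover obtain E where "E \<in> C" using False by blast
      then have "Inf C \<le> F0" using CS Inf_lower[of E C] unfolding S_def by (auto intro: order_trans)
      ultimately have "Inf C \<in> S" unfolding S_def by blast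
      moreover have "\<forall>E\<in>C. Inf C \<le> E" by (simp add: Inf_lower)
      ultimately show ?thesis by (rule rev_bexI)
    qed
  qed
  then obtain W where W: "W \<noteq> bot" "W \<le> F0" "\<And>E. E \<noteq> bot \<Longrightarrow> E \<le> W \<Longrightarrow> E = W"
    unfolding S_def by (auto intro: order_trans)
  have "eventually P W \<or> eventually (\<lambda>x. \<not> P x) W" for P
  proof (cases "inf W (principal {x. P x}) = bot")
    case True
    then have "eventually (\<lambda>x. False) (inf W (principal {x. P x}))" by simp
    then show ?thesis by (simp add: eventually_inf_principal)
  next
    case False
    then have "inf W (principal {x. P x}) = W" by (intro W(3)) auto
    moreover have "eventually P (inf W (principal {x. P x}))" by (simp add: eventually_inf_principal)
    ultimately show ?thesis by simp
  qed
  then show ?thesis using that W unfolding ultra_def by blast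
qed

lemma ultra_base:
  assumes "F \<noteq> {}" "\<And>A. A \<in> F \<Longrightarrow> A \<noteq> {}" "\<And>A B. A \<in> F \<Longrightarrow> B \<in> F \<Longrightarrow> \<exists>C\<in>F. C \<subseteq> A \<inter> B"
  obtains W where "ultra W" "\<And>A. A \<in> F \<Longrightarrow> eventually (\<lambda>x. x \<in> A) W"
proof -
  have "eventually P (INF A\<in>F. principal A) \<longleftrightarrow> (\<exists>A\<in>F. eventually P (principal A))" for P
    by (rule eventually_INF_base) (use assms in auto)
  then have ev: "eventually P (INF A\<in>F. principal A) \<longleftrightarrow> (\<exists>A\<in>F. \<forall>x\<in>A. P x)" for P
    by (simp add: eventually_principal)
  have "(INF A\<in>F. principal A) \<noteq> bot" using assms(2) by (auto simp: trivial_limit_def ev)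
  then obtain W where W: "ultra W" "W \<le> (INF A\<in>F. principal A)" by (rule ultra_le)
  have "eventually (\<lambda>x. x \<in> A) W" if "A \<in> F" for A
    using filter_leD[OF W(2)] ev that by blast
  then show ?thesis using that W(1) by blast
qed

text \<open>An ultrafilter on tuples encodes a global type; over \<open>C\<close> its realizations are the points lying in exactly
  those \<open>C\<close>-definable sets that belong to it.  If it concentrates on \<open>M\<close>-tuples, this global type is finitely
  satisfiable in \<open>M\<close>, hence invariant over \<open>M\<close>.\<close>
definition realizes_ultra :: "('a, 'r) struct \<Rightarrow> nat \<Rightarrow> 'a list filter \<Rightarrow> 'a set \<Rightarrow> 'a list \<Rightarrow> bool" where
  "realizes_ultra U k W C d \<longleftrightarrow> d \<in> tuples U k \<and> (\<forall>P. dfn U C k P \<longrightarrow> P d = eventually P W)"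

lemma realizes_ultra_mono: "realizes_ultra U k W D d \<Longrightarrow> C \<subseteq> D \<Longrightarrow> realizes_ultra U k W C d"
  unfolding realizes_ultra_def using dfn_mono by blast

lemma realizes_ultra_append:
  assumes "realizes_ultra U k W C d" "c \<in> tuples U l" "set c \<subseteq> C"
  shows "realizes_ultra U (k + l) (filtermap (\<lambda>z. z @ c) W) C (d @ c)"
  using assms dfn_const[OF assms(2,3)] unfolding realizes_ultra_def
  by (auto simp: eventually_filtermap tuples_appendI)

definition same_type :: "('a, 'r) struct \<Rightarrow> 'a set \<Rightarrow> nat \<Rightarrow> 'a list \<Rightarrow> 'a list \<Rightarrow> bool" where
  "same_type U C k u v \<longleftrightarrow> u \<in> tuples U k \<and> v \<in> tuples U k \<and> (\<forall>P. dfn U C k P \<longrightarrow> P u = P v)"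

definition morley :: "('a, 'r) struct \<Rightarrow> nat \<Rightarrow> 'a list filter \<Rightarrow> 'a set \<Rightarrow> (nat \<Rightarrow> 'a list) \<Rightarrow> bool" where
  "morley U k W C x \<longleftrightarrow> (\<forall>i. realizes_ultra U k W (C \<union> (\<Union>j<i. set (x j))) (x i))"

lemma morley_append:
  assumes "morley U k W C x" "c \<in> tuples U l" "set c \<subseteq> C"
  shows "morley U (k + l) (filtermap (\<lambda>z. z @ c) W) C (\<lambda>i. x i @ c)"
  unfolding morley_def
proof
  fix i
  have "C \<union> (\<Union>j<i. set (x j @ c)) = C \<union> (\<Union>j<i. set (x j))" using assms(3) by auto
  then show "realizes_ultra U (k + l) (filtermap (\<lambda>z. z @ c) W) (C \<union> (\<Union>j<i. set (x j @ c))) (x i @ c)"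
    using assms(1,3) unfolding morley_def by (auto intro!: realizes_ultra_append assms)
qed

lemma concat_tuples: "(\<And>i. x i \<in> tuples U k) \<Longrightarrow> concat (map x is) \<in> tuples U (k * length is)"
  by (induction "is") (auto simp: tuples_def)

lemma sorted_wrt_snoc: "sorted_wrt (<) (xs @ [i]) \<Longrightarrow> set xs \<subseteq> {..<i::nat} \<and> sorted_wrt (<) xs"
  by (auto simp: sorted_wrt_append)

text \<open>By induction on the number of terms: the last term can be exchanged for a
  \<open>W\<close>-generic \<open>z\<close>, whatever its index, provided the other indices are
  smaller. As \<open>W\<close> concentrates on tuples from \<open>C\<close>, fixing \<open>z\<close>
  leaves a condition over \<open>C\<close> on fewer terms.\<close>

lemma morley_indisc:
  assumes W: "ultra W" "eventually (\<lambda>z. set z \<subseteq> C) W" "eventually (\<lambda>z. z \<in> tuples U k) W"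
    and x: "morley U k W C x"
    and "length is = length js" "sorted_wrt (<) is" "sorted_wrt (<) js"
    and "dfn U C (k * length is) P"
  shows "P (concat (map x is)) = P (concat (map x js))"
  using assms(5-)
proof (induction "length is" arbitrary: "is" js P)
  case 0
  then show ?case by simp
next
  case (Suc N)
  have xt: "x i \<in> tuples U k" for i using x unfolding morley_def realizes_ultra_def by blast
  obtain is' i where i: "is = is' @ [i]" using Suc(2) by (metis length_Suc_conv_rev)
  obtain js' j where j: "js = js' @ [j]" using Suc(2,3) by (metis length_Suc_conv_rev)
  have l: "length is' = N" "length js' = N" using Suc(2,3) i j by auto
  have si: "set is' \<subseteq> {..<i}" "sorted_wrt (<) is'" using Suc(4) i sorted_wrt_snoc by blast+
  have sj: "set js' \<subseteq> {..<j}" "sorted_wrt (<) js'" using Suc(5) j sorted_wrt_snoc by blast+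
  have P: "dfn U C (k * N + k) P" using Suc.prems(4) Suc(2) by (metis add.commute mult_Suc_right)
  have key: "P (concat (map x as) @ x i) = eventually (\<lambda>z. P (concat (map x as) @ z)) W"
    if as: "set as \<subseteq> {..<i}" "length as = N" for as i
  proof -
    have "concat (map x as) \<in> tuples U (k * N)" using concat_tuples[where x = x, OF xt] as(2) by blast
    moreover have "set (concat (map x as)) \<subseteq> C \<union> (\<Union>j<i. set (x j))" using as(1) by auto
    ultimately have "dfn U (C \<union> (\<Union>j<i. set (x j))) k (\<lambda>z. P (concat (map x as) @ z))"
      by (rule dfn_const_left) (rule dfn_mono[OF P], simp)
    then show ?thesis using x unfolding morley_def realizes_ultra_def by blast
  qed
  \<comment> \<open>For each fixed \<open>z\<close> from \<open>C\<close> the induction hypothesis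
    applies, with \<open>z\<close> absorbed as a parameter.\<close>
  have "eventually (\<lambda>z. P (concat (map x is') @ z) = P (concat (map x js') @ z)) W"
    using W(2,3)
  proof eventually_elim
    case (elim z)
    show ?case
      using dfn_const[OF elim(2,1) P] l si sj by (intro Suc(1)[of is' js' "\<lambda>u. P (u @ z)"]) auto
  qed
  then have "eventually (\<lambda>z. P (concat (map x is') @ z)) W = eventually (\<lambda>z. P (concat (map x js') @ z)) W"
    by (rule eventually_subst)
  then show ?case using key[OF si(1) l(1)] key[OF sj(1) l(2)] i j by simp
qed

lemma morley_indiscernible:
  assumes "ultra W" "eventually (\<lambda>z. set z \<subseteq> C) W" "eventually (\<lambda>z. z \<in> tuples U k) W" "morley U k W C x"
  shows "indiscernible U k x"
  unfolding indiscernible_def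
proof (intro conjI allI impI)
  show "x i \<in> tuples U k" for i using assms(4) unfolding morley_def realizes_ultra_def by blast
next
  fix \<psi> :: "'b fm" and "is" js :: "nat list"
  assume *: "length is = length js" "sorted_wrt (<) is" "sorted_wrt (<) js" "fv \<psi> \<subseteq> {..<k * length is}"
  have "dfn U C (k * length is) (\<lambda>a. sat U (nth a) \<psi>)"
    by (rule dfnI[of \<psi> _ "[]"]) (use * in auto)
  then show "sat U (nth (concat (map x is))) \<psi> \<longleftrightarrow> sat U (nth (concat (map x js))) \<psi>"
    using morley_indisc[OF assms *(1-3)] by blast
qed

text \<open>Grouping consecutive terms lifts primality from two terms to \<open>2 ^ k\<close> terms,
  and to conditions on disjoint pairs of terms.\<close>

lemma indiscernible_double:
  assumes "indiscernible U m b"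
  shows "indiscernible U (m + m) (\<lambda>i. b (2 * i) @ b (2 * i + 1))"
proof -
  \<comment> \<open>\<open>D\<close> turns an increasing list of pair indices into the increasing
    list of the underlying indices.\<close>
  define D where "D = (\<lambda>is. concat (map (\<lambda>i::nat. [2 * i, 2 * i + 1]) is))"
  have len: "length (D is) = 2 * length is" for "is"
    unfolding D_def by (induction "is") auto
  have srt: "sorted_wrt (<) is \<Longrightarrow> sorted_wrt (<) (D is)" for "is"
    unfolding D_def by (induction "is") auto
  have cc: "concat (map (\<lambda>i. b (2 * i) @ b (2 * i + 1)) is) = concat (map b (D is))" for "is"
    unfolding D_def by (induction "is") auto
  show ?thesis unfolding indiscernible_def
  proof (intro conjI allI impI)
    show "b (2 * i) @ b (2 * i + 1) \<in> tuples U (m + m)" for i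
      using assms unfolding indiscernible_def by (blast intro: tuples_appendI)
  next
    fix \<psi> :: "'b fm" and "is" js :: "nat list"
    assume *: "length is = length js" "sorted_wrt (<) is" "sorted_wrt (<) js" "fv \<psi> \<subseteq> {..<(m + m) * length is}"
    have "(m + m) * length is = m * length (D is)" by (simp add: len algebra_simps)
    then show "sat U (nth (concat (map (\<lambda>i. b (2 * i) @ b (2 * i + 1)) is))) \<psi> \<longleftrightarrow>
      sat U (nth (concat (map (\<lambda>i. b (2 * i) @ b (2 * i + 1)) js))) \<psi>"
      using assms * len srt unfolding cc indiscernible_def by (metis (no_types, lifting))
  qed
qed

text \<open>Each new term may depend on the whole history, not just on the previous term, and a
  prescribed initial segment \<open>ys\<close> survives in the limit.\<close>

lemma dependent_list_choice:
  assumes "Good ys" "\<And>xs. Good xs \<Longrightarrow> \<exists>y. Good (xs @ [y])"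
  obtains f :: "nat \<Rightarrow> 'b" where "map f [0..<length ys] = ys" "\<And>i. length ys \<le> i \<Longrightarrow> Good (map f [0..<i])"
proof -
  define g where "g i = ((\<lambda>xs. xs @ [SOME y. Good (xs @ [y])]) ^^ i) ys" for i
  define f where "f i = g (Suc i) ! i" for i
  have gS: "g (Suc i) = g i @ [SOME y. Good (g i @ [y])]" for i unfolding g_def by simp
  have len: "length (g i) = length ys + i" for i by (induction i) (simp_all add: gS, simp add: g_def)
  have good: "Good (g i)" for i
  proof (induction i)
    case 0
    then show ?case using assms(1) by (simp add: g_def)
  next
    case (Suc i)
    then show ?case unfolding gS by (intro someI_ex[of "\<lambda>y. Good (g i @ [y])"] assms(2))
  qed
  have pre: "g (i + j) ! t = g i ! t" if "t < length ys + i" for i j t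
    using that by (induction j) (auto simp: gS nth_append len)
  have gf: "g i = map f [0..<length ys + i]" for i
  proof (rule nth_equalityI)
    fix t assume "t < length (g i)"
    then have t: "t < length ys + i" by (simp add: len)
    have "g i ! t = g (i + Suc t) ! t" using pre[OF t, of "Suc t"] by simp
    also have "\<dots> = g (Suc t) ! t" using pre[of t "Suc t" i] by (simp add: add.commute)
    finally show "g i ! t = map f [0..<length ys + i] ! t" using t by (simp add: f_def)
  qed (simp add: len)
  show ?thesis
  proof (rule that[of f])
    show "map f [0..<length ys] = ys" using gf[of 0] by (simp add: g_def)
    show "Good (map f [0..<i])" if "length ys \<le> i" for i
      using good[of "i - length ys"] gf[of "i - length ys"] that by simp
  qed
qed

section \<open>Saturation: small parameter sets and realizations of ultrafilters\<close>

locale saturated_pair =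
  fixes U :: "('a, 'r) struct" and M :: "'a set"
  assumes elem: "elem_sub M U" and saturated: "saturated_over U M"
begin

text \<open>The cardinal bound is that of \<open>saturated_over\<close>. It is infinite and admits
  \<open>M\<close>, so adding finitely or countably many tuples to \<open>M\<close> stays within the
  reach of saturation.\<close>

definition small :: "'a set \<Rightarrow> bool" where
  "small C \<longleftrightarrow> C \<subseteq> fst U \<and>
     (card_of C, card_of (Pow (M <+> (UNIV :: 'r set) <+> (UNIV :: nat set)))) \<in> ordLeq"

lemma M_sub: "M \<subseteq> fst U"
  using elem unfolding elem_sub_def by blast

lemma small_sub: "small C \<Longrightarrow> C \<subseteq> fst U"
  unfolding small_def by blast

lemma infinite_bound: "infinite (Pow (M <+> (UNIV :: 'r set) <+> (UNIV :: nat set)))"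
  by (auto dest!: finite_PlusD(2) simp: finite_Plus_iff)

lemma small_M: "small M"
proof -
  have "(card_of M, card_of (M <+> (UNIV :: 'r set) <+> (UNIV :: nat set))) \<in> ordLeq" by (rule card_of_Plus1)
  also have "(card_of (M <+> (UNIV :: 'r set) <+> (UNIV :: nat set)),
    card_of (Pow (M <+> (UNIV :: 'r set) <+> (UNIV :: nat set)))) \<in> ordLeq"
    by (rule ordLess_imp_ordLeq[OF card_of_Pow])
  finally show ?thesis unfolding small_def using M_sub by blast
qed

lemma small_Un: "small C \<Longrightarrow> small D \<Longrightarrow> small (C \<union> D)"
  unfolding small_def
  by (intro conjI Un_least card_of_Un_ordLeq_infinite_Field card_of_Card_order)
    (use infinite_bound in \<open>simp_all only: Field_card_of\<close>, simp_all)

lemma small_range: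
  fixes f :: "nat \<Rightarrow> 'a"
  assumes "range f \<subseteq> fst U"
  shows "small (range f)"
proof -
  have "(card_of (range f), card_of (UNIV :: nat set)) \<in> ordLeq" by (rule card_of_image)
  also have "(card_of (UNIV :: nat set), card_of ((UNIV :: 'r set) <+> (UNIV :: nat set))) \<in> ordLeq" by (rule card_of_Plus2)
  also have "(card_of ((UNIV :: 'r set) <+> (UNIV :: nat set)), card_of (M <+> (UNIV :: 'r set) <+> (UNIV :: nat set))) \<in> ordLeq" by (rule card_of_Plus2)
  also have "(card_of (M <+> (UNIV :: 'r set) <+> (UNIV :: nat set)),
    card_of (Pow (M <+> (UNIV :: 'r set) <+> (UNIV :: nat set)))) \<in> ordLeq"
    by (rule ordLess_imp_ordLeq[OF card_of_Pow])
  finally show ?thesis unfolding small_def using assms by blast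
qed

lemma small_countable: "C \<subseteq> fst U \<Longrightarrow> C = {} \<or> (\<exists>f :: nat \<Rightarrow> 'a. C = range f) \<Longrightarrow> small C"
proof (elim disjE exE)
  assume "C \<subseteq> fst U" "C = {}"
  moreover have "small ({} \<union> M) \<Longrightarrow> small {}"
    unfolding small_def using card_of_empty by blast
  ultimately show "small C" using small_M by simp
qed (auto intro: small_range)

lemma small_set: "set c \<subseteq> fst U \<Longrightarrow> small (set c)"
proof (cases "c = []")
  case False
  assume "set c \<subseteq> fst U"
  moreover have "set c = range (\<lambda>i. if i < length c then c ! i else hd c)"
    proof (intro equalityI subsetI)
    fix a assume "a \<in> set c"
    then obtain i where "i < length c" "a = c ! i" by (auto simp: in_set_conv_nth)
    then have "a = (\<lambda>i. if i < length c then c ! i else hd c) i" by simp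
    then show "a \<in> range (\<lambda>i. if i < length c then c ! i else hd c)" by blast
  qed (use False in auto)
  ultimately show ?thesis by (intro small_countable) blast+
qed (auto intro: small_countable)

lemma small_UN_set:
  fixes x :: "nat \<Rightarrow> 'a list"
  assumes "\<And>i. x i \<in> tuples U k"
  shows "small (\<Union>i. set (x i))"
proof (cases "k = 0")
  case True
  then have "(\<Union>i. set (x i)) = {}" using tuplesD(1)[OF assms] by auto
  then show ?thesis by (auto intro: small_countable)
next
  case False
  have len: "length (x i) = k" for i using tuplesD(1)[OF assms] .
  \<comment> \<open>Entry \<open>j\<close> of \<open>x i\<close> is listed at index
    \<open>i * k + j\<close>, which makes the union countable.\<close>
  have "(\<Union>i. set (x i)) = range (\<lambda>t. x (t div k) ! (t mod k))"
  proof (intro equalityI subsetI)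
    fix a assume "a \<in> (\<Union>i. set (x i))"
    then obtain i j where "j < k" "a = x i ! j" using len by (auto simp: in_set_conv_nth)
    then have "a = (\<lambda>t. x (t div k) ! (t mod k)) (i * k + j)" by simp
    then show "a \<in> range (\<lambda>t. x (t div k) ! (t mod k))" by blast
  next
    fix a assume "a \<in> range (\<lambda>t. x (t div k) ! (t mod k))"
    then obtain t where "a = x (t div k) ! (t mod k)" by blast
    moreover have "t mod k < length (x (t div k))" using False len by simp
    ultimately show "a \<in> (\<Union>i. set (x i))" by (metis UN_I UNIV_I nth_mem)
  qed
  moreover have "(\<Union>i. set (x i)) \<subseteq> fst U" using tuplesD(2)[OF assms] by blast
  ultimately show ?thesis by (intro small_countable) blast+
qed

text \<open>The \<open>W\<close>-large formulas over \<open>C\<close> are finitely satisfiable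
  because \<open>W\<close> is closed under finite intersections. Since \<open>W\<close> decides
  every formula, a realization of them also refutes the formulas that are not
  \<open>W\<close>-large.\<close>

lemma realizes_ultra_exists:
  assumes "small C" "ultra W" "eventually (\<lambda>z. z \<in> tuples U k) W"
  obtains d where "realizes_ultra U k W C d"
proof -
  define p where "p = {(\<phi>, bs) \<in> fmls_over C k. eventually (\<lambda>z. sat U (nth (z @ bs)) \<phi>) W}"
  have "fin_sat U k p" unfolding fin_sat_def
  proof (intro allI impI)
    fix q assume q: "q \<subseteq> p" "finite q"
    have "eventually (\<lambda>z. \<forall>(\<phi>, bs)\<in>q. sat U (nth (z @ bs)) \<phi>) W"
      using q unfolding p_def by (intro eventually_ball_finite) auto
    with assms(3) have "eventually (\<lambda>z. realizes U k z q) W"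
      unfolding realizes_def by eventually_elim auto
    then show "\<exists>a. realizes U k a q" using ultra_happens[OF assms(2)] by blast
  qed
  moreover have "p \<subseteq> fmls_over C k" unfolding p_def by blast
  ultimately obtain a where a: "realizes U k a p"
    using saturated assms(1) unfolding saturated_over_def small_def by meson
  then have at: "a \<in> tuples U k" unfolding realizes_def by blast
  have "P a = eventually P W" if P: "dfn U C k P" for P
  proof -
    obtain \<phi> bs where 1: "fv \<phi> \<subseteq> {..<k + length bs}" "set bs \<subseteq> C"
      "\<And>a. a \<in> tuples U k \<Longrightarrow> P a \<longleftrightarrow> sat U (nth (a @ bs)) \<phi>" using P by (rule dfnE) blast
    have "eventually (\<lambda>z. P z = sat U (nth (z @ bs)) \<phi>) W"
      using assms(3) by (rule eventually_mono) (rule 1(3))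
    then have ev: "eventually P W = eventually (\<lambda>z. sat U (nth (z @ bs)) \<phi>) W" by (rule eventually_subst)
    show ?thesis
    proof (cases "eventually P W")
      case True
      then have "(\<phi>, bs) \<in> p" using 1 ev unfolding p_def fmls_over_def by auto
      then show ?thesis using a True 1(3)[OF at] unfolding realizes_def by auto
    next
      case False
      then have "(Neg \<phi>, bs) \<in> p" using 1 ev ultra_not[OF assms(2)] unfolding p_def fmls_over_def by auto
      then show ?thesis using a False 1(3)[OF at] unfolding realizes_def by auto
    qed
  qed
  then show ?thesis using that at unfolding realizes_ultra_def by blast
qed

text \<open>Initial terms are prescribed because the applications need Morley sequences that begin
  with points already at hand. The sequence continues since finitely many tuples keep the parameter
  set small.\<close>

lemma morley_extend:
  assumes C: "small C" and W: "ultra W" "eventually (\<lambda>z. z \<in> tuples U k) W"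
    and ys: "\<And>i. i < length ys \<Longrightarrow> realizes_ultra U k W (C \<union> (\<Union>y\<in>set (take i ys). set y)) (ys ! i)"
  obtains x where "morley U k W C x" "map x [0..<length ys] = ys"
proof -
  define Good where "Good ys \<longleftrightarrow> (\<forall>i<length ys. realizes_ultra U k W (C \<union> (\<Union>y\<in>set (take i ys). set y)) (ys ! i))" for ys
  have "\<exists>y. Good (xs @ [y])" if xs: "Good xs" for xs
  proof -
    have "y \<in> tuples U k" if "y \<in> set xs" for y
      using xs that unfolding Good_def realizes_ultra_def by (metis in_set_conv_nth)
    then have "set (concat xs) \<subseteq> fst U" by (auto dest: tuplesD(2))
    then have "small (C \<union> set (concat xs))" by (intro small_Un C small_set)
    then obtain y where "realizes_ultra U k W (C \<union> set (concat xs)) y" using realizes_ultra_exists W by blast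
    then have "Good (xs @ [y])" using xs unfolding Good_def by (auto simp: less_Suc_eq nth_append)
    then show ?thesis ..
  qed
  moreover have "Good ys" using ys unfolding Good_def by blast
  ultimately obtain f where f: "map f [0..<length ys] = ys" "\<And>i. length ys \<le> i \<Longrightarrow> Good (map f [0..<i])"
    using dependent_list_choice[of Good ys] by metis
  have "realizes_ultra U k W (C \<union> (\<Union>j<i. set (f j))) (f i)" for i
  proof -
    have "Good (map f [0..<length ys + Suc i])" by (rule f(2)) simp
    then have "realizes_ultra U k W (C \<union> (\<Union>y\<in>set (take i (map f [0..<length ys + Suc i])). set y)) (map f [0..<length ys + Suc i] ! i)"
      unfolding Good_def by simp
    then show ?thesis by (simp add: take_map lessThan_atLeast0 del: upt_Suc)
  qed
  then show ?thesis using that f(1) unfolding morley_def by blast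
qed

end

subsection \<open>Groups with a prime ideal\<close>

lemma definable_over_dfn: "definable_over U k C X \<Longrightarrow> dfn U C k (\<lambda>x. x \<in> X)"
  unfolding definable_over_def dfn_def by (fastforce simp: defset_def)

lemma dfn_definable_over: "dfn U C k P \<Longrightarrow> definable_over U k C {a \<in> tuples U k. P a}"
  unfolding definable_over_def dfn_def defset_def by fast

lemma dfn_all_less: "(\<And>j. j < N \<Longrightarrow> dfn U C k (P j)) \<Longrightarrow> dfn U C k (\<lambda>a. \<forall>j<N::nat. P j a)"
proof (induction N)
  case 0
  then show ?case by (simp add: dfn_True)
next
  case (Suc N)
  then have "dfn U C k (\<lambda>a. (\<forall>j<N. P j a) \<and> P N a)" by (intro dfn_conj) auto
  then show ?case by (rule dfn_cong) (auto simp: less_Suc_eq)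
qed

lemma dfn_swap:
  assumes "dfn U C (k + l) P"
  shows "dfn U C (l + k) (\<lambda>a. P (drop l a @ take l a))"
proof -
  have "coord (l + k) (k + l) (\<lambda>a. take k (drop l a) @ take l (drop 0 a))"
    by (intro coord_append coord_take_drop) auto
  from dfn_coord[OF assms this] show ?thesis
    by (rule dfn_cong) (auto dest!: tuplesD(1))
qed

lemma indiscernible_tuples: "indiscernible U m b \<Longrightarrow> b i \<in> tuples U m"
  unfolding indiscernible_def by blast

lemma take_block: "length x = k \<Longrightarrow> take k (x @ y) = x" "length x = k \<Longrightarrow> take k x = x"
  and drop_block: "length x = k \<Longrightarrow> drop k (x @ y) = y" "length x = k \<Longrightarrow> drop (k + l) (x @ y) = drop l y"
  by auto

lemmas blocks = take_block drop_block drop_0 append_assoc add.assoc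

locale prime_ideal_group = saturated_pair U M for U :: "('a, 'r) struct" and M +
  fixes n :: nat and Gr :: "'a list monoid" and I :: "'a list set set"
  assumes dg: "definable_group U n Gr" and infG: "infinite (carrier Gr)"
    and ideal: "is_ideal U n Gr I" and linv: "left_invariant Gr I"
    and prime: "indiscernibly_prime U n Gr I" and tdef: "type_definable_empty U n Gr I"
begin

abbreviation "G \<equiv> carrier Gr"

sublocale group Gr
  using dg unfolding definable_group_def by blast

lemma G_tuples: "x \<in> G \<Longrightarrow> x \<in> tuples U n"
  using dg unfolding definable_group_def by blast

lemma dfn_G: "dfn U C n (\<lambda>x. x \<in> G)"
  using dg unfolding definable_group_def by (blast intro: dfn_mono[OF definable_over_dfn])

abbreviation "graph \<equiv> {x @ y @ z | x y z. x \<in> G \<and> y \<in> G \<and> z = x \<otimes>\<^bsub>Gr\<^esub> y}"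

lemma dfn_graph: "dfn U C (n + (n + n)) (\<lambda>a. a \<in> graph)"
proof -
  have "dfn U {} (3 * n) (\<lambda>a. a \<in> graph)"
    using dg unfolding definable_group_def by (blast intro: definable_over_dfn)
  moreover have "3 * n = n + (n + n)" by simp
  ultimately show ?thesis by (metis (no_types, lifting) dfn_mono empty_subsetI)
qed

lemma graph_iff:
  "length x = n \<Longrightarrow> length y = n \<Longrightarrow> x @ y @ z \<in> graph \<longleftrightarrow> x \<in> G \<and> y \<in> G \<and> z = x \<otimes>\<^bsub>Gr\<^esub> y"
proof
  assume l: "length x = n" "length y = n" and "x @ y @ z \<in> graph"
  then obtain x' y' where *: "x' \<in> G" "y' \<in> G" "x @ y @ z = x' @ y' @ (x' \<otimes>\<^bsub>Gr\<^esub> y')" by blast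
  have "length x' = n" "length y' = n" using *(1,2) by (auto intro: tuplesD(1)[OF G_tuples])
  then show "x \<in> G \<and> y \<in> G \<and> z = x \<otimes>\<^bsub>Gr\<^esub> y" using * l by auto
qed blast

lemma dfn_mult:
  assumes "dfn U C n P"
  shows "dfn U C (n + n) (\<lambda>a. take n a \<in> G \<and> drop n a \<in> G \<and> P (take n a \<otimes>\<^bsub>Gr\<^esub> drop n a))"
proof -
  have "dfn U C (n + n + n) (\<lambda>a. take n (drop 0 a) @ take n (drop n a) @ take n (drop (n + n) a) \<in> graph)"
    by (rule dfn_coord[OF dfn_graph]) (intro coord_append coord_take_drop; simp)
  moreover have "dfn U C (n + n + n) (\<lambda>a. P (take n (drop (n + n) a)))"
    by (rule dfn_coord[OF assms coord_take_drop]) simp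
  ultimately have "dfn U C (n + n) (\<lambda>a. \<exists>u\<in>tuples U n.
      take n (drop 0 (a @ u)) @ take n (drop n (a @ u)) @ take n (drop (n + n) (a @ u)) \<in> graph
      \<and> P (take n (drop (n + n) (a @ u))))"
    by (intro dfn_ex dfn_conj)
  then show ?thesis
  proof (rule dfn_cong)
    fix a assume a: "a \<in> tuples U (n + n)"
    have l: "length a = n + n" using a by (rule tuplesD)
    have "(take n (drop 0 (a @ u)) @ take n (drop n (a @ u)) @ take n (drop (n + n) (a @ u)) \<in> graph
        \<and> P (take n (drop (n + n) (a @ u)))) \<longleftrightarrow>
        take n a \<in> G \<and> drop n a \<in> G \<and> u = take n a \<otimes>\<^bsub>Gr\<^esub> drop n a \<and> P u" if "u \<in> tuples U n" for u
      using l tuplesD(1)[OF that] graph_iff[of "take n a" "drop n a" u] by simp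
    moreover have "take n a \<otimes>\<^bsub>Gr\<^esub> drop n a \<in> tuples U n" if "take n a \<in> G" "drop n a \<in> G"
      using that G_tuples by blast
    ultimately show "(\<exists>u\<in>tuples U n.
      take n (drop 0 (a @ u)) @ take n (drop n (a @ u)) @ take n (drop (n + n) (a @ u)) \<in> graph
      \<and> P (take n (drop (n + n) (a @ u)))) = (take n a \<in> G \<and> drop n a \<in> G \<and> P (take n a \<otimes>\<^bsub>Gr\<^esub> drop n a))"
      by auto
  qed
qed

lemma dfn_translate:
  assumes "dfn U C n P" "b \<in> G" "set b \<subseteq> C"
  shows "dfn U C n (\<lambda>x. x \<in> G \<and> P (b \<otimes>\<^bsub>Gr\<^esub> x))"
  by (rule dfn_cong[OF dfn_const_left[OF G_tuples[OF assms(2)] assms(3) dfn_mult[OF assms(1)]]])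
    (use assms(2) tuplesD(1)[OF G_tuples[OF assms(2)]] in auto)

lemma left_div_iff: "g \<in> G \<Longrightarrow> u \<in> G \<and> x = g \<otimes>\<^bsub>Gr\<^esub> u \<longleftrightarrow> x \<in> G \<and> u = inv\<^bsub>Gr\<^esub> g \<otimes>\<^bsub>Gr\<^esub> x"
  by (auto simp: m_assoc[symmetric])

text \<open>Only the graph of multiplication is given as definable. The quotient is reached as the
  unique solution \<open>u\<close> of \<open>g u = x\<close>, which is then quantified away. The
  predicate expresses that \<open>take n a\<close> lies in the translate of \<open>P\<close> by
  \<open>drop n a\<close>.\<close>

lemma dfn_coset:
  assumes "dfn U C n P"
  shows "dfn U C (n + n) (\<lambda>a. take n a \<in> G \<and> drop n a \<in> G \<and> P (inv\<^bsub>Gr\<^esub> (drop n a) \<otimes>\<^bsub>Gr\<^esub> take n a))"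
proof -
  have "dfn U C (n + n + n) (\<lambda>a. take n (drop n a) @ take n (drop (n + n) a) @ take n (drop 0 a) \<in> graph)"
    by (rule dfn_coord[OF dfn_graph]) (intro coord_append coord_take_drop; simp)
  moreover have "dfn U C (n + n + n) (\<lambda>a. P (take n (drop (n + n) a)))"
    by (rule dfn_coord[OF assms coord_take_drop]) simp
  ultimately have "dfn U C (n + n) (\<lambda>a. \<exists>u\<in>tuples U n.
      take n (drop n (a @ u)) @ take n (drop (n + n) (a @ u)) @ take n (drop 0 (a @ u)) \<in> graph
      \<and> P (take n (drop (n + n) (a @ u))))"
    by (intro dfn_ex dfn_conj)
  then show ?thesis
  proof (rule dfn_cong)
    fix a assume a: "a \<in> tuples U (n + n)"
    have l: "length a = n + n" using a by (rule tuplesD)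
    have "(take n (drop n (a @ u)) @ take n (drop (n + n) (a @ u)) @ take n (drop 0 (a @ u)) \<in> graph
        \<and> P (take n (drop (n + n) (a @ u)))) \<longleftrightarrow>
        take n a \<in> G \<and> drop n a \<in> G \<and> u = inv\<^bsub>Gr\<^esub> (drop n a) \<otimes>\<^bsub>Gr\<^esub> take n a \<and> P u"
      if "u \<in> tuples U n" for u
    proof -
      have blk: "take n (drop n (a @ u)) = drop n a" "take n (drop (n + n) (a @ u)) = u" "take n (drop 0 (a @ u)) = take n a"
        using l tuplesD(1)[OF that] by simp_all
      have "drop n a @ u @ take n a \<in> graph \<longleftrightarrow> drop n a \<in> G \<and> u \<in> G \<and> take n a = drop n a \<otimes>\<^bsub>Gr\<^esub> u"
        by (rule graph_iff) (use l tuplesD(1)[OF that] in simp_all)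
      then show ?thesis unfolding blk using left_div_iff[of "drop n a" u "take n a"] by blast
    qed
    moreover have "inv\<^bsub>Gr\<^esub> (drop n a) \<otimes>\<^bsub>Gr\<^esub> take n a \<in> tuples U n" if "take n a \<in> G" "drop n a \<in> G"
      by (intro G_tuples m_closed inv_closed that)
    ultimately show "(\<exists>u\<in>tuples U n.
      take n (drop n (a @ u)) @ take n (drop (n + n) (a @ u)) @ take n (drop 0 (a @ u)) \<in> graph
      \<and> P (take n (drop (n + n) (a @ u)))) =
      (take n a \<in> G \<and> drop n a \<in> G \<and> P (inv\<^bsub>Gr\<^esub> (drop n a) \<otimes>\<^bsub>Gr\<^esub> take n a))"
      by auto
  qed
qed

lemma empty_I: "{} \<in> I"
  using ideal unfolding is_ideal_def by blast

lemma I_mono: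
  assumes "X \<in> I" "dfn U (fst U) n Q" "{x \<in> G. Q x} \<subseteq> X"
  shows "{x \<in> G. Q x} \<in> I"
proof -
  have "{x \<in> G. Q x} = {a \<in> tuples U n. a \<in> G \<and> Q a}" using G_tuples by blast
  then have "{x \<in> G. Q x} \<in> def_subsets U n Gr" unfolding def_subsets_def
    using dfn_definable_over[OF dfn_conj[OF dfn_G assms(2)]] by auto
  then show ?thesis using ideal assms(1,3) unfolding is_ideal_def by blast
qed

text \<open>Invariance under \<open>b\<close> gives one direction, invariance under its inverse the
  other.\<close>

lemma I_translate:
  assumes "b \<in> G"
  shows "{x \<in> G. P (b \<otimes>\<^bsub>Gr\<^esub> x)} \<in> I \<longleftrightarrow> {x \<in> G. P x} \<in> I"
proof
  have 1: "(\<lambda>x. b \<otimes>\<^bsub>Gr\<^esub> x) ` {x \<in> G. P (b \<otimes>\<^bsub>Gr\<^esub> x)} = {x \<in> G. P x}"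
  proof (intro equalityI subsetI)
    fix x assume x: "x \<in> {x \<in> G. P x}"
    then have "x = b \<otimes>\<^bsub>Gr\<^esub> (inv\<^bsub>Gr\<^esub> b \<otimes>\<^bsub>Gr\<^esub> x)" using assms by (simp add: m_assoc[symmetric])
    then show "x \<in> (\<lambda>x. b \<otimes>\<^bsub>Gr\<^esub> x) ` {x \<in> G. P (b \<otimes>\<^bsub>Gr\<^esub> x)}"
      using x assms by (intro image_eqI[where x = "inv\<^bsub>Gr\<^esub> b \<otimes>\<^bsub>Gr\<^esub> x"]) auto
  qed (use assms in auto)
  show "{x \<in> G. P (b \<otimes>\<^bsub>Gr\<^esub> x)} \<in> I \<Longrightarrow> {x \<in> G. P x} \<in> I"
    using linv assms 1 unfolding left_invariant_def by metis
  have 2: "(\<lambda>x. inv\<^bsub>Gr\<^esub> b \<otimes>\<^bsub>Gr\<^esub> x) ` {x \<in> G. P x} = {x \<in> G. P (b \<otimes>\<^bsub>Gr\<^esub> x)}"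
    unfolding 1[symmetric] image_image using assms by (force simp: m_assoc[symmetric])
  show "{x \<in> G. P x} \<in> I \<Longrightarrow> {x \<in> G. P (b \<otimes>\<^bsub>Gr\<^esub> x)} \<in> I"
    using linv assms 2 unfolding left_invariant_def by (metis inv_closed)
qed

text \<open>Type-definability with the parameters from \<open>C\<close> absorbed: \<open>S\<close>
  is a partial type over \<open>C\<close>. Hence thinness of an instance depends only on the type of
  \<open>b\<close> over \<open>C\<close>, and wideness is witnessed by the failure of one definable
  condition.\<close>

lemma I_closed:
  assumes "dfn U C (n + k) Q" "C \<subseteq> fst U"
  obtains S where "\<And>P. P \<in> S \<Longrightarrow> dfn U C k P"
    "\<And>b. b \<in> tuples U k \<Longrightarrow> {x \<in> G. Q (x @ b)} \<in> I \<longleftrightarrow> (\<forall>P\<in>S. P b)"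
proof -
  obtain \<phi> c where 1: "fv \<phi> \<subseteq> {..<n + k + length c}" "set c \<subseteq> C"
    "\<And>a. a \<in> tuples U (n + k) \<Longrightarrow> Q a \<longleftrightarrow> sat U (nth (a @ c)) \<phi>" using assms(1) by (rule dfnE) blast
  then have "fv \<phi> \<subseteq> {..<n + (k + length c)}" by (simp add: add.assoc)
  then have "\<exists>\<Sigma>. (\<forall>\<sigma>\<in>\<Sigma>. fv \<sigma> \<subseteq> {..<k + length c}) \<and>
      (\<forall>b\<in>tuples U (k + length c). (\<forall>\<sigma>\<in>\<Sigma>. sat U (nth b) \<sigma>) \<longleftrightarrow> inst U n Gr \<phi> b \<in> I)"
    by (rule tdef[unfolded type_definable_empty_def, rule_format])
  then obtain \<Sigma> where \<Sigma>: "\<forall>\<sigma>\<in>\<Sigma>. fv \<sigma> \<subseteq> {..<k + length c}"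
    "\<forall>b\<in>tuples U (k + length c). (\<forall>\<sigma>\<in>\<Sigma>. sat U (nth b) \<sigma>) \<longleftrightarrow> inst U n Gr \<phi> b \<in> I"
    by (elim exE conjE)
  show ?thesis
  proof (rule that[of "(\<lambda>\<sigma> b. sat U (nth (b @ c)) \<sigma>) ` \<Sigma>"])
    show "dfn U C k P" if "P \<in> (\<lambda>\<sigma> b. sat U (nth (b @ c)) \<sigma>) ` \<Sigma>" for P
      using that \<Sigma>(1) 1(2) by (auto intro: dfnI[where bs = c])
    fix b assume b: "b \<in> tuples U k"
    then have "b @ c \<in> tuples U (k + length c)" using 1(2) assms(2) by (auto simp: tuples_def)
    moreover have "inst U n Gr \<phi> (b @ c) = {x \<in> G. Q (x @ b)}"
      unfolding inst_def defset_def using G_tuples 1(3)[OF tuples_appendI[OF G_tuples b]] by auto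
    ultimately show "{x \<in> G. Q (x @ b)} \<in> I \<longleftrightarrow> (\<forall>P\<in>(\<lambda>\<sigma> b. sat U (nth (b @ c)) \<sigma>) ` \<Sigma>. P b)"
      using \<Sigma>(2) by auto
  qed
qed

section \<open>Primality along indiscernible and Morley sequences\<close>

lemma prime_two:
  assumes "indiscernible U m b" "dfn U {} (n + m) P" "{x \<in> G. P (x @ b 0)} \<notin> I"
  shows "{x \<in> G. P (x @ b 0) \<and> P (x @ b 1)} \<notin> I"
proof -
  obtain \<phi> where 1: "fv \<phi> \<subseteq> {..<n + m}"
    "\<And>a. a \<in> tuples U (n + m) \<Longrightarrow> P a \<longleftrightarrow> sat U (nth a) \<phi>"
    using assms(2) by (rule dfnE) simp
  have "inst U n Gr \<phi> (b i) = {x \<in> G. P (x @ b i)}" for i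
    unfolding inst_def defset_def
    using G_tuples 1(2)[OF tuples_appendI[OF G_tuples indiscernible_tuples[OF assms(1)]]] by auto
  moreover have "{x \<in> G. P (x @ b 0)} \<inter> {x \<in> G. P (x @ b 1)} = {x \<in> G. P (x @ b 0) \<and> P (x @ b 1)}"
    by blast
  moreover have "inst U n Gr \<phi> (b 0) \<inter> inst U n Gr \<phi> (b 1) \<in> I \<longrightarrow> inst U n Gr \<phi> (b 0) \<in> I"
    using prime 1(1) assms(1) unfolding indiscernibly_prime_def by blast
  ultimately show ?thesis using assms(3) by (simp only:) blast
qed

text \<open>Pairing consecutive terms of the sequence doubles the number of sets in the intersection.\<close>
lemma prime_pow:
  assumes "indiscernible U m b" "dfn U {} (n + m) P" "{x \<in> G. P (x @ b 0)} \<notin> I"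
  shows "{x \<in> G. \<forall>j<2 ^ k. P (x @ b j)} \<notin> I"
  using assms
proof (induction k arbitrary: m b P)
  case 0
  then show ?case by simp
next
  case (Suc k)
  let ?b = "\<lambda>i. b (2 * i) @ b (2 * i + 1)"
  let ?P = "\<lambda>a. P (take n (drop 0 a) @ take m (drop n a)) \<and> P (take n (drop 0 a) @ take m (drop (n + m) a))"
  have P: "dfn U {} (n + (m + m)) ?P"
    by (intro dfn_conj dfn_coord[OF Suc.prems(2)] coord_append coord_take_drop) auto
  have eq: "?P (x @ ?b i) \<longleftrightarrow> P (x @ b (2 * i)) \<and> P (x @ b (2 * i + 1))" if "x \<in> G" for x i
    by (simp only: blocks tuplesD(1)[OF G_tuples[OF that]] tuplesD(1)[OF indiscernible_tuples[OF Suc.prems(1)]])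
  have "?P (x @ ?b 0) \<longleftrightarrow> P (x @ b 0) \<and> P (x @ b 1)" if "x \<in> G" for x
    using eq[OF that, of 0] by (simp only: mult_0_right add_0_left)
  then have "{x \<in> G. ?P (x @ ?b 0)} = {x \<in> G. P (x @ b 0) \<and> P (x @ b 1)}"
    by (intro Collect_cong conj_cong[of "x \<in> G" "x \<in> G" for x]) (rule refl)
  then have "{x \<in> G. ?P (x @ ?b 0)} \<notin> I" using prime_two[OF Suc.prems] by metis
  then have "{x \<in> G. \<forall>j<2 ^ k. ?P (x @ ?b j)} \<notin> I"
    by (rule Suc.IH[OF indiscernible_double[OF Suc.prems(1)] P])
  also have "{x \<in> G. \<forall>j<2 ^ k. ?P (x @ ?b j)} = {x \<in> G. \<forall>j<2 ^ Suc k. P (x @ b j)}"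
  proof (intro Collect_cong conj_cong refl)
    fix x assume x: "x \<in> G"
    have "(\<forall>j<2 ^ k. P (x @ b (2 * j)) \<and> P (x @ b (2 * j + 1))) \<longleftrightarrow> (\<forall>j<2 ^ Suc k. P (x @ b j))"
    proof (intro iffI allI impI)
      fix j :: nat
      assume *: "\<forall>j<2 ^ k. P (x @ b (2 * j)) \<and> P (x @ b (2 * j + 1))" and "j < 2 ^ Suc k"
      then have "j div 2 < 2 ^ k" by auto
      moreover have "j = 2 * (j div 2) \<or> j = 2 * (j div 2) + 1" by presburger
      ultimately show "P (x @ b j)" using * by metis
    qed auto
    then show "(\<forall>j<2 ^ k. ?P (x @ ?b j)) = (\<forall>j<2 ^ Suc k. P (x @ b j))" unfolding eq[OF x] .
  qed
  finally show ?case .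
qed

lemma morley_tuples: "morley U k W C w \<Longrightarrow> w i \<in> tuples U k"
  unfolding morley_def realizes_ultra_def by blast

lemma morley_indiscernible_const:
  assumes "ultra W" "eventually (\<lambda>z. set z \<subseteq> C) W" "eventually (\<lambda>z. z \<in> tuples U k) W" "morley U k W C w"
    "set c \<subseteq> C" "C \<subseteq> fst U"
  shows "indiscernible U (k + length c) (\<lambda>i. w i @ c)"
proof -
  have c: "c \<in> tuples U (length c)" using assms(5,6) by (auto simp: tuples_def)
  show ?thesis
  proof (rule morley_indiscernible[OF ultra_filtermap[OF assms(1)] _ _ morley_append[OF assms(4) c assms(5)]])
    show "eventually (\<lambda>z. set z \<subseteq> C) (filtermap (\<lambda>z. z @ c) W)"
      using assms(2,5) by (simp add: eventually_filtermap)
    show "eventually (\<lambda>z. z \<in> tuples U (k + length c)) (filtermap (\<lambda>z. z @ c) W)"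
      using assms(3) unfolding eventually_filtermap by (rule eventually_mono) (rule tuples_appendI[OF _ c])
  qed
qed

text \<open>The parameters are moved into the terms \<open>w i @ c\<close>, which remain
  indiscernible. Powers of two suffice, since the first \<open>2 ^ N\<close> conditions include the
  first \<open>N\<close>.\<close>

lemma prime_morley:
  assumes "ultra W" "eventually (\<lambda>z. set z \<subseteq> C) W" "eventually (\<lambda>z. z \<in> tuples U k) W" "morley U k W C w"
    "C \<subseteq> fst U" "dfn U C (n + k) P" "{x \<in> G. P (x @ w 0)} \<notin> I"
  shows "{x \<in> G. \<forall>j<N. P (x @ w j)} \<notin> I"
proof
  assume N: "{x \<in> G. \<forall>j<N. P (x @ w j)} \<in> I"
  obtain c P' where c: "set c \<subseteq> C" "dfn U {} (n + k + length c) P'"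
    "\<And>a. a \<in> tuples U (n + k) \<Longrightarrow> P a \<longleftrightarrow> P' (a @ c)" by (rule dfn_params[OF assms(6)]) (rule that)
  have eq: "P' (x @ w i @ c) = P (x @ w i)" if "x \<in> G" for x i
    using c(3)[OF tuples_appendI[OF G_tuples[OF that] morley_tuples[OF assms(4)]]] by simp
  have "{x \<in> G. P' (x @ w 0 @ c)} = {x \<in> G. P (x @ w 0)}" using eq by blast
  then have "{x \<in> G. \<forall>j<2 ^ N. P' (x @ w j @ c)} \<notin> I"
    using assms(7) c(2) by (intro prime_pow[OF morley_indiscernible_const[OF assms(1-4) c(1) assms(5)]]) (simp_all add: add.assoc)
  moreover have "{x \<in> G. \<forall>j<2 ^ N. P' (x @ w j @ c)} = {x \<in> G. \<forall>j<2 ^ N. P (x @ w j)}"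
    using eq by auto
  moreover have "{x \<in> G. \<forall>j<2 ^ N. P (x @ w j)} \<in> I"
  proof (rule I_mono[OF N])
    have "dfn U (fst U) n (\<lambda>x. P (x @ w j))" for j
      using tuplesD(2)[OF morley_tuples[OF assms(4)]] assms(5)
      by (intro dfn_const[OF morley_tuples[OF assms(4)]] dfn_mono[OF assms(6)])
    then show "dfn U (fst U) n (\<lambda>x. \<forall>j<2 ^ N. P (x @ w j))" by (intro dfn_all_less)
    have "j < N \<Longrightarrow> j < 2 ^ N" for j by (metis less_exp less_trans)
    then show "{x \<in> G. \<forall>j<2 ^ N. P (x @ w j)} \<subseteq> {x \<in> G. \<forall>j<N. P (x @ w j)}" by blast
  qed
  ultimately show False by simp
qed

text \<open>The set depends on two terms at once, so primality is applied to the sequence of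
  consecutive pairs. Stability needs this when the wide meets lie off the diagonal.\<close>

lemma prime_morley_pairs:
  assumes "ultra W" "eventually (\<lambda>z. set z \<subseteq> C) W" "eventually (\<lambda>z. z \<in> tuples U k) W" "morley U k W C w"
    "C \<subseteq> fst U" "dfn U C (n + (k + k)) P" "{x \<in> G. P (x @ w 0 @ w 1)} \<notin> I"
  shows "{x \<in> G. P (x @ w 0 @ w 1) \<and> P (x @ w 2 @ w 3)} \<notin> I"
proof -
  obtain c P' where c: "set c \<subseteq> C" "dfn U {} (n + (k + k) + length c) P'"
    "\<And>a. a \<in> tuples U (n + (k + k)) \<Longrightarrow> P a \<longleftrightarrow> P' (a @ c)" by (rule dfn_params[OF assms(6)]) (rule that)
  let ?l = "length c"
  let ?b = "\<lambda>i. (w (2 * i) @ c) @ (w (2 * i + 1) @ c)"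
  \<comment> \<open>Reads off the variable, the two members of the pair and the first of the two
    copies of \<open>c\<close>.\<close>
  let ?F = "\<lambda>a :: 'a list. (take n (drop 0 a) @ take k (drop n a) @ take k (drop (n + k + ?l) a)) @ take ?l (drop (n + k) a)"
  have "coord (n + ((k + ?l) + (k + ?l))) (n + (k + k) + ?l) ?F"
    by (intro coord_append coord_take_drop) auto
  then have P: "dfn U {} (n + ((k + ?l) + (k + ?l))) (\<lambda>a. P' (?F a))" by (rule dfn_coord[OF c(2)])
  have eq: "P' (?F (x @ ?b i)) \<longleftrightarrow> P (x @ w (2 * i) @ w (2 * i + 1))" if "x \<in> G" for x i
  proof -
    have "length x = n" "\<And>i. length (w i) = k"
      using tuplesD(1)[OF G_tuples[OF that]] tuplesD(1)[OF morley_tuples[OF assms(4)]] by auto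
    then have "?F (x @ ?b i) = (x @ w (2 * i) @ w (2 * i + 1)) @ c" by (simp only: blocks)
    moreover have "x @ w (2 * i) @ w (2 * i + 1) \<in> tuples U (n + (k + k))"
      by (intro tuples_appendI G_tuples[OF that] morley_tuples[OF assms(4)])
    ultimately show ?thesis by (simp only: c(3))
  qed
  have eq0: "P' (?F (x @ ?b 0)) \<longleftrightarrow> P (x @ w 0 @ w 1)" if "x \<in> G" for x
    using eq[OF that, of 0] by (simp only: mult_0_right add_0_left)
  have "(2::nat) * 1 + 1 = 3" by simp
  then have eq1: "P' (?F (x @ ?b 1)) \<longleftrightarrow> P (x @ w 2 @ w 3)" if "x \<in> G" for x
    using eq[OF that, of 1] by (simp only: mult_1_right)
  have e0: "{x \<in> G. P' (?F (x @ ?b 0))} = {x \<in> G. P (x @ w 0 @ w 1)}"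
    by (intro Collect_cong conj_cong refl eq0)
  have e1: "{x \<in> G. P' (?F (x @ ?b 0)) \<and> P' (?F (x @ ?b 1))} = {x \<in> G. P (x @ w 0 @ w 1) \<and> P (x @ w 2 @ w 3)}"
    by (intro Collect_cong conj_cong refl eq0 eq1)
  have "indiscernible U ((k + ?l) + (k + ?l)) ?b"
    by (rule indiscernible_double[OF morley_indiscernible_const[OF assms(1-4) c(1) assms(5)]])
  from prime_two[OF this P] show ?thesis using assms(7) unfolding e0 e1 by blast
qed

subsection \<open>Stability and stationarity\<close>

text \<open>With \<open>P (x @ g)\<close> expressing \<open>x \<in> g B\<close>, this says that \<open>g B \<inter> h B\<close> is in the ideal.\<close>
definition thin_meet :: "('a list \<Rightarrow> bool) \<Rightarrow> 'a list \<Rightarrow> 'a list \<Rightarrow> bool" where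
  "thin_meet P g h \<longleftrightarrow> {x \<in> G. P (x @ g) \<and> P (x @ h)} \<in> I"

lemma thin_meet_commute: "thin_meet P g h = thin_meet P h g"
  unfolding thin_meet_def by (simp add: conj_commute)

text \<open>By \<open>I_closed\<close>, thinness of the meet is given by a partial type over
  \<open>M\<close> in the pair, so it is a property of the joint type.\<close>

lemma thin_meet_same_type:
  assumes P: "dfn U M (n + n) P" and eq: "same_type U M (n + n) (g @ h) (g' @ h')"
    and len: "g \<in> tuples U n" "g' \<in> tuples U n"
  shows "thin_meet P g h = thin_meet P g' h'"
proof -
  let ?Q = "\<lambda>a. P (take n (drop 0 a) @ take n (drop n a)) \<and> P (take n (drop 0 a) @ take n (drop (n + n) a))"
  have "dfn U M (n + (n + n)) ?Q"
    by (intro dfn_conj dfn_coord[OF P] coord_append coord_take_drop) auto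
  then obtain S where S: "\<And>P. P \<in> S \<Longrightarrow> dfn U M (n + n) P"
    "\<And>b. b \<in> tuples U (n + n) \<Longrightarrow> {x \<in> G. ?Q (x @ b)} \<in> I \<longleftrightarrow> (\<forall>P\<in>S. P b)"
    using I_closed[OF _ M_sub] by blast
  have rel: "thin_meet P g h \<longleftrightarrow> (\<forall>P\<in>S. P (g @ h))" if gh: "g \<in> tuples U n" "g @ h \<in> tuples U (n + n)" for g h
  proof -
    have "h \<in> tuples U n" using gh tuples_append[of g n h n U] tuplesD(1)[OF gh(1)] by blast
    then have "?Q (x @ g @ h) \<longleftrightarrow> P (x @ g) \<and> P (x @ h)" if "x \<in> G" for x
      by (simp only: blocks tuplesD(1)[OF G_tuples[OF that]] tuplesD(1)[OF gh(1)] tuplesD(1)[of h U n])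
    then have *: "{x \<in> G. ?Q (x @ g @ h)} = {x \<in> G. P (x @ g) \<and> P (x @ h)}"
      by (intro Collect_cong conj_cong[of "x \<in> G" "x \<in> G" for x]) (rule refl)
    show ?thesis unfolding thin_meet_def *[symmetric] by (rule S(2)[OF gh(2)])
  qed
  have "(\<forall>P\<in>S. P (g @ h)) \<longleftrightarrow> (\<forall>P\<in>S. P (g' @ h'))"
    using eq S(1) unfolding same_type_def by blast
  then show ?thesis using rel eq len unfolding same_type_def by blast
qed

text \<open>An ultrafilter on the given sequence of pairs that contains all its tails has a Morley sequence which is
  indiscernible and realizes the same pattern, with the order reversed.  If the two types disagreed about
  \<open>thin_meet\<close>, wide meets along this sequence would have thin pairwise intersections,
  contradicting primality.\<close>
lemma thin_meet_stable:
  fixes x e :: "nat \<Rightarrow> 'a list"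
  assumes P: "dfn U M (n + n) P"
    and xe: "\<And>k. x k \<in> tuples U n" "\<And>k. e k \<in> tuples U n"
    and le: "\<And>j k. j \<le> k \<Longrightarrow> same_type U M (n + n) (x j @ e k) (a1 @ b1)"
    and gt: "\<And>j k. k < j \<Longrightarrow> same_type U M (n + n) (x j @ e k) (a2 @ b2)"
    and t: "a1 \<in> tuples U n" "a2 \<in> tuples U n"
  shows "thin_meet P a1 b1 = thin_meet P a2 b2"
proof -
  define z where "z k = x k @ e k" for k
  define C where "C = M \<union> (\<Union>k. set (z k))"
  have zt: "z k \<in> tuples U (n + n)" for k unfolding z_def using xe by (rule tuples_appendI)
  have len: "length (x k) = n" "length (e k) = n" for k using xe by (auto dest: tuplesD(1))
  have C: "small C" unfolding C_def by (intro small_Un small_M small_UN_set[OF zt])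
  have CU: "C \<subseteq> fst U" by (rule small_sub[OF C])
  have MC: "M \<subseteq> C" unfolding C_def by blast
  have zC: "set (x k) \<subseteq> C" "set (e k) \<subseteq> C" for k unfolding C_def z_def by auto
  obtain W where W: "ultra W" "\<And>A. A \<in> range (\<lambda>k. z ` {k..}) \<Longrightarrow> eventually (\<lambda>x. x \<in> A) W"
  proof (rule ultra_base[of "range (\<lambda>k. z ` {k..})"])
    fix A B assume "A \<in> range (\<lambda>k. z ` {k..})" "B \<in> range (\<lambda>k. z ` {k..})"
    then obtain k l where "A = z ` {k..}" "B = z ` {l..}" by blast
    then show "\<exists>C\<in>range (\<lambda>k. z ` {k..}). C \<subseteq> A \<inter> B"
      by (intro bexI[of _ "z ` {max k l..}"]) auto
  qed auto
  \<comment> \<open>A condition that is constant on a tail of \<open>z\<close> is decided by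
    \<open>W\<close> accordingly; the evaluations below reduce to this.\<close>
  have ev: "eventually Q W = v" if "\<And>j. K \<le> j \<Longrightarrow> Q (z j) = v" for Q K v
  proof -
    have "eventually (\<lambda>u. u \<in> z ` {K..}) W" by (rule W(2)) blast
    then have "eventually (\<lambda>u. Q u = v) W" by (rule eventually_mono) (use that in auto)
    then show ?thesis using ultra_not[OF W(1), of Q] by (cases v) auto
  qed
  have WC: "eventually (\<lambda>z. set z \<subseteq> C) W"
    using ev[of 0 "\<lambda>z. set z \<subseteq> C" True] unfolding C_def by auto
  have Wt: "eventually (\<lambda>z. z \<in> tuples U (n + n)) W"
    using ev[of 0 "\<lambda>z. z \<in> tuples U (n + n)" True] zt by simp
  obtain w where w: "morley U (n + n) W C w" using morley_extend[OF C W(1) Wt, of "[]"] by auto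
  define xx where "xx i = take n (w i)" for i
  define ee where "ee i = drop n (w i)" for i
  have wt: "w i \<in> tuples U (n + n)" for i by (rule morley_tuples[OF w])
  have wxe: "w i = xx i @ ee i" for i unfolding xx_def ee_def by simp
  have xxt: "xx i \<in> tuples U n" for i
    using wt[of i] unfolding xx_def tuples_def by (auto dest: in_set_takeD)
  have eet: "ee i \<in> tuples U n" for i
    using wt[of i] unfolding ee_def tuples_def by (auto dest: in_set_dropD)
  have wr: "Q (w i) = eventually Q W" if "dfn U (C \<union> set (concat (map w [0..<i]))) (n + n) Q" for Q i
  proof -
    have "set (concat (map w [0..<i])) = (\<Union>j<i. set (w j))" by auto
    then show ?thesis using w that unfolding morley_def realizes_ultra_def by auto
  qed
  have d1: "dfn U D (n + n) (\<lambda>v. Q (c @ drop n v))"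
    if "dfn U M (n + n) Q" "c \<in> tuples U n" "set c \<subseteq> D" "M \<subseteq> D" for Q c D
  proof -
    have "dfn U D n (\<lambda>u. Q (c @ u))" by (rule dfn_const_left[OF that(2,3) dfn_mono[OF that(1,4)]])
    from dfn_coord[OF this coord_take_drop[of n n "n + n"]] show ?thesis
      by (rule dfn_cong) (auto dest!: tuplesD(1))
  qed
  have d2: "dfn U D (n + n) (\<lambda>v. Q (take n v @ c))"
    if "dfn U M (n + n) Q" "c \<in> tuples U n" "set c \<subseteq> D" "M \<subseteq> D" for Q c D
  proof -
    have "dfn U D n (\<lambda>u. Q (u @ c))" by (rule dfn_const[OF that(2,3) dfn_mono[OF that(1,4)]])
    from dfn_coord[OF this coord_take_drop[of 0 n "n + n"]] show ?thesis by simp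
  qed
  have zi: "take n (z j) = x j" "drop n (z j) = e j" for j unfolding z_def using len by auto
  have e1: "Q (x j @ e k) = Q (a1 @ b1)" if "dfn U M (n + n) Q" "j \<le> k" for Q j k
    using le that unfolding same_type_def by blast
  have e2: "Q (x j @ e k) = Q (a2 @ b2)" if "dfn U M (n + n) Q" "k < j" for Q j k
    using gt that unfolding same_type_def by blast
  have diag: "Q (xx i @ ee i) = Q (a1 @ b1)" if Q: "dfn U M (n + n) Q" for Q i
  proof -
    have "Q (w i) = eventually Q W" by (rule wr[OF dfn_mono[OF Q]]) (use MC in auto)
    also have "\<dots> = Q (a1 @ b1)" by (rule ev[of 0]) (simp add: z_def e1[OF Q])
    finally show ?thesis unfolding wxe .
  qed
  \<comment> \<open>The later term is evaluated first: \<open>ee k\<close> becomes some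
    \<open>e j\<close>, and then \<open>xx i\<close> becomes an \<open>x l\<close> with
    \<open>l > j\<close>, because \<open>W\<close> contains all tails. The smaller index on the left
    thus gives the second type, which is the reversal of the order.\<close>
  have lt: "Q (xx i @ ee k) = Q (a2 @ b2)" if Q: "dfn U M (n + n) Q" and ik: "i < k" for Q i k
  proof -
    have "set (xx i) \<subseteq> C \<union> set (concat (map w [0..<k]))"
      using ik unfolding xx_def by (auto dest: in_set_takeD)
    then have "Q (xx i @ drop n (w k)) = eventually (\<lambda>v. Q (xx i @ drop n v)) W"
      using MC by (intro wr d1[OF Q xxt]) auto
    also have "\<dots> = Q (a2 @ b2)"
    proof (rule ev[of 0])
      fix j
      have "Q (take n (w i) @ e j) = eventually (\<lambda>v. Q (take n v @ e j)) W"
        using MC zC(2)[of j] by (intro wr d2[OF Q xe(2)]) auto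
      also have "\<dots> = Q (a2 @ b2)" by (rule ev[of "Suc j"]) (simp add: zi e2[OF Q])
      finally show "Q (xx i @ drop n (z j)) = Q (a2 @ b2)" unfolding zi xx_def .
    qed
    finally show ?thesis unfolding ee_def .
  qed
  \<comment> \<open>Now the left component is later: it becomes some \<open>x j\<close> first, and
    \<open>ee k\<close> then becomes an \<open>e l\<close> with \<open>l \<ge> j\<close>, a pair of
    the first type.\<close>
  have gt': "Q (xx i @ ee k) = Q (a1 @ b1)" if Q: "dfn U M (n + n) Q" and ik: "k < i" for Q i k
  proof -
    have "set (ee k) \<subseteq> C \<union> set (concat (map w [0..<i]))"
      using ik unfolding ee_def by (auto dest: in_set_dropD)
    then have "Q (take n (w i) @ ee k) = eventually (\<lambda>v. Q (take n v @ ee k)) W"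
      using MC by (intro wr d2[OF Q eet]) auto
    also have "\<dots> = Q (a1 @ b1)"
    proof (rule ev[of 0])
      fix j
      have "Q (x j @ drop n (w k)) = eventually (\<lambda>v. Q (x j @ drop n v)) W"
        using MC zC(1)[of j] by (intro wr d1[OF Q xe(1)]) auto
      also have "\<dots> = Q (a1 @ b1)" by (rule ev[of j]) (simp add: zi e1[OF Q])
      finally show "Q (take n (z j) @ ee k) = Q (a1 @ b1)" unfolding zi ee_def .
    qed
    finally show ?thesis unfolding xx_def .
  qed
  have ab: "a1 @ b1 \<in> tuples U (n + n)" "a2 @ b2 \<in> tuples U (n + n)"
    using le[of 0 0] gt[of 0 1] unfolding same_type_def by auto
  have R1: "thin_meet P (xx i) (ee k) = thin_meet P a1 b1" if "k \<le> i" for i k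
  proof (rule thin_meet_same_type[OF P _ xxt t(1)])
    have "Q (xx i @ ee k) = Q (a1 @ b1)" if "dfn U M (n + n) Q" for Q
      using diag[OF that] gt'[OF that, of k i] \<open>k \<le> i\<close> by (cases "k = i") auto
    then show "same_type U M (n + n) (xx i @ ee k) (a1 @ b1)"
      unfolding same_type_def using ab(1) tuples_appendI[OF xxt eet] by blast
  qed
  have R2: "thin_meet P (xx i) (ee k) = thin_meet P a2 b2" if "i < k" for i k
  proof (rule thin_meet_same_type[OF P _ xxt t(2)])
    show "same_type U M (n + n) (xx i @ ee k) (a2 @ b2)"
      unfolding same_type_def using ab(2) tuples_appendI[OF xxt eet] lt[OF _ that] by blast
  qed
  have xel: "length (xx i) = n" "length (ee i) = n" for i
    using tuplesD(1)[OF xxt] tuplesD(1)[OF eet] by auto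
  have dC: "dfn U (fst U) n (\<lambda>u. P (u @ c))" if "c \<in> tuples U n" for c
    by (rule dfn_const[OF that tuplesD(2)[OF that] dfn_mono[OF P M_sub]])
  show ?thesis
  proof (rule ccontr)
    assume "thin_meet P a1 b1 \<noteq> thin_meet P a2 b2"
    then consider "\<not> thin_meet P a1 b1" "thin_meet P a2 b2" | "thin_meet P a1 b1" "\<not> thin_meet P a2 b2" by blast
    then show False
    proof cases
      \<comment> \<open>The diagonal meets are wide. Two of them intersect inside the meet for
        \<open>xx 0\<close> and \<open>ee 1\<close>, which has the second type and is thin.\<close>
      case 1
      let ?Q = "\<lambda>a. P (take n (drop 0 a) @ take n (drop n a)) \<and> P (take n (drop 0 a) @ take n (drop (n + n) a))"
      have Q: "dfn U C (n + (n + n)) ?Q"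
        by (intro dfn_conj dfn_coord[OF dfn_mono[OF P MC]] coord_append coord_take_drop) auto
      have eq: "?Q (u @ w i) \<longleftrightarrow> P (u @ xx i) \<and> P (u @ ee i)" if "u \<in> G" for u i
        unfolding wxe by (simp only: blocks tuplesD(1)[OF G_tuples[OF that]] xel)
      have "{u \<in> G. ?Q (u @ w 0)} = {u \<in> G. P (u @ xx 0) \<and> P (u @ ee 0)}"
        by (intro Collect_cong conj_cong[of "u \<in> G" "u \<in> G" for u] eq) (rule refl)
      then have "{u \<in> G. ?Q (u @ w 0)} \<notin> I" using 1(1) R1[of 0 0] unfolding thin_meet_def by auto
      from prime_morley[OF W(1) WC Wt w CU Q this, of 2]
      have "{u \<in> G. \<forall>j<2::nat. ?Q (u @ w j)} \<notin> I" .
      also have "{u \<in> G. \<forall>j<2::nat. ?Q (u @ w j)} = {u \<in> G. \<forall>j<2::nat. P (u @ xx j) \<and> P (u @ ee j)}"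
        using eq by blast
      finally have "{u \<in> G. \<forall>j<2::nat. P (u @ xx j) \<and> P (u @ ee j)} \<notin> I" .
      moreover have "{u \<in> G. \<forall>j<2::nat. P (u @ xx j) \<and> P (u @ ee j)} \<in> I"
      proof (rule I_mono)
        show "{u \<in> G. P (u @ xx 0) \<and> P (u @ ee 1)} \<in> I" using 1(2) R2[of 0 1] unfolding thin_meet_def by auto
        show "dfn U (fst U) n (\<lambda>u. \<forall>j<2::nat. P (u @ xx j) \<and> P (u @ ee j))"
          by (intro dfn_all_less dfn_conj dC xxt eet)
        show "{u \<in> G. \<forall>j<2::nat. P (u @ xx j) \<and> P (u @ ee j)} \<subseteq> {u \<in> G. P (u @ xx 0) \<and> P (u @ ee 1)}"
          by (auto simp: numeral_2_eq_2)
      qed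
      ultimately show False by blast
    next
      \<comment> \<open>The meets at the index pairs (0, 1) and (2, 3) are wide. They intersect
        inside the meet for \<open>xx 2\<close> and \<open>ee 1\<close>, which has the first type
        since 1 < 2, and is thin.\<close>
      case 2
      let ?Q = "\<lambda>a. P (take n (drop 0 a) @ take n (drop n a)) \<and> P (take n (drop 0 a) @ take n (drop (n + n + n + n) a))"
      have Q: "dfn U C (n + ((n + n) + (n + n))) ?Q"
        by (intro dfn_conj dfn_coord[OF dfn_mono[OF P MC]] coord_append coord_take_drop) auto
      have eq: "?Q (u @ w i @ w j) \<longleftrightarrow> P (u @ xx i) \<and> P (u @ ee j)" if "u \<in> G" for u i j
        unfolding wxe by (simp only: blocks tuplesD(1)[OF G_tuples[OF that]] xel)
      have "{u \<in> G. ?Q (u @ w 0 @ w 1)} = {u \<in> G. P (u @ xx 0) \<and> P (u @ ee 1)}"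
        by (intro Collect_cong conj_cong[of "u \<in> G" "u \<in> G" for u] eq) (rule refl)
      then have "{u \<in> G. ?Q (u @ w 0 @ w 1)} \<notin> I" using 2(2) R2[of 0 1] unfolding thin_meet_def by auto
      from prime_morley_pairs[OF W(1) WC Wt w CU Q this]
      have "{u \<in> G. ?Q (u @ w 0 @ w 1) \<and> ?Q (u @ w 2 @ w 3)} \<notin> I" .
      also have "{u \<in> G. ?Q (u @ w 0 @ w 1) \<and> ?Q (u @ w 2 @ w 3)} =
          {u \<in> G. (P (u @ xx 0) \<and> P (u @ ee 1)) \<and> (P (u @ xx 2) \<and> P (u @ ee 3))}"
        by (intro Collect_cong conj_cong[of "u \<in> G" "u \<in> G" for u] arg_cong2[of _ _ _ _ "(\<and>)"] eq) (rule refl)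
      finally have "{u \<in> G. (P (u @ xx 0) \<and> P (u @ ee 1)) \<and> (P (u @ xx 2) \<and> P (u @ ee 3))} \<notin> I" .
      moreover have "{u \<in> G. (P (u @ xx 0) \<and> P (u @ ee 1)) \<and> (P (u @ xx 2) \<and> P (u @ ee 3))} \<in> I"
      proof (rule I_mono)
        show "{u \<in> G. P (u @ xx 2) \<and> P (u @ ee 1)} \<in> I" using 2(1) R1[of 1 2] unfolding thin_meet_def by auto
        show "dfn U (fst U) n (\<lambda>u. (P (u @ xx 0) \<and> P (u @ ee 1)) \<and> (P (u @ xx 2) \<and> P (u @ ee 3)))"
          by (intro dfn_conj dC xxt eet)
      qed auto
      ultimately show False by blast
    qed
  qed
qed

section \<open>Wide points and amalgamation over a Morley sequence\<close>

lemma notin_I_nonempty: "X \<notin> I \<Longrightarrow> X \<noteq> {}"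
  using empty_I by blast

definition wide_over :: "'a set \<Rightarrow> 'a list \<Rightarrow> bool" where
  "wide_over C e \<longleftrightarrow> e \<in> G \<and> (\<forall>P. dfn U C n P \<longrightarrow> P e \<longrightarrow> {x \<in> G. P x} \<notin> I)"

lemma wide_over_mono: "wide_over D e \<Longrightarrow> C \<subseteq> D \<Longrightarrow> wide_over C e"
  unfolding wide_over_def using dfn_mono by blast

text \<open>A formula over \<open>M\<close> true of \<open>(x, e)\<close> defines a wide set over
  \<open>x\<close>, as \<open>e\<close> is wide there. By primality its conjugates over all terms of
  \<open>xs\<close> have a common point, and compactness collects all formulas in one
  \<open>y\<close>. The wideness is asked of \<open>e\<close>, not of \<open>y\<close>, so the same
  \<open>e\<close> serves again for longer lists.\<close>

lemma wide_amalgamation: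
  assumes V: "ultra V" "eventually (\<lambda>z. set z \<subseteq> M) V" "eventually (\<lambda>z. z \<in> tuples U n) V"
    and xs: "\<And>i. i < length xs \<Longrightarrow> realizes_ultra U n V (M \<union> (\<Union>y\<in>set (take i xs). set y)) (xs ! i)"
    and x: "xs \<noteq> []" "xs ! 0 = x" and e: "wide_over (M \<union> set x) e"
  obtains y where "y \<in> tuples U n" "\<And>j. j < length xs \<Longrightarrow> same_type U M (n + n) (xs ! j @ y) (x @ e)"
proof -
  let ?N = "length xs"
  obtain X where X: "morley U n V M X" "map X [0..<?N] = xs"
    by (rule morley_extend[OF small_M V(1,3), of xs]) (erule xs, rule that)
  have Xj: "X j = xs ! j" if "j < ?N" for j
    using that X(2) by (metis add_0 diff_zero length_upt nth_map nth_upt)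
  have Xt: "X j \<in> tuples U n" for j by (rule morley_tuples[OF X(1)])
  have X0: "X 0 = x" using Xj[of 0] x by simp
  define S where "S P = {y \<in> tuples U n. \<forall>j<?N. P (X j @ y)}" for P
  \<comment> \<open>The type of \<open>(x, e)\<close> over \<open>M\<close>. It is closed under
    conjunction, so the sets \<open>S P\<close> form a filter base once they are nonempty.\<close>
  define T where "T = {P. dfn U M (n + n) P \<and> P (x @ e)}"
  obtain W where W: "ultra W" "\<And>A. A \<in> S ` T \<Longrightarrow> eventually (\<lambda>x. x \<in> A) W"
  proof (rule ultra_base[of "S ` T"])
    have "(\<lambda>_. True) \<in> T" unfolding T_def by (simp add: dfn_True)
    then show "S ` T \<noteq> {}" by blast
  next
    fix A B assume "A \<in> S ` T" "B \<in> S ` T"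
    then obtain P Q where *: "A = S P" "B = S Q" "P \<in> T" "Q \<in> T" by blast
    then have "(\<lambda>a. P a \<and> Q a) \<in> T" unfolding T_def by (auto intro: dfn_conj)
    moreover have "S (\<lambda>a. P a \<and> Q a) \<subseteq> A \<inter> B" unfolding * S_def by blast
    ultimately show "\<exists>C\<in>S ` T. C \<subseteq> A \<inter> B" by blast
  next
    fix A assume "A \<in> S ` T"
    then obtain P where P: "A = S P" "dfn U M (n + n) P" "P (x @ e)" unfolding T_def by blast
    let ?P = "\<lambda>a. P (drop n a @ take n a)"
    have eq: "?P (y @ X j) = P (X j @ y)" if "y \<in> G" for y j
      using tuplesD(1)[OF G_tuples[OF that]] by simp
    have "dfn U (M \<union> set x) n (\<lambda>y. P (x @ y))"
      using Xt[of 0] unfolding X0 by (rule dfn_const_left) (auto intro: dfn_mono[OF P(2)])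
    then have "{y \<in> G. P (x @ y)} \<notin> I" using e P(3) unfolding wide_over_def by blast
    moreover have "{y \<in> G. P (x @ y)} = {y \<in> G. ?P (y @ X 0)}" using eq[of _ 0] unfolding X0 by blast
    ultimately have "{y \<in> G. ?P (y @ X 0)} \<notin> I" by simp
    have "{y \<in> G. \<forall>j<?N. ?P (y @ X j)} \<noteq> {}"
      by (rule notin_I_nonempty, rule prime_morley[OF V X(1) M_sub dfn_swap[OF P(2)]]) fact
    then obtain y where "y \<in> G" "\<forall>j<?N. P (X j @ y)" using eq by blast
    then show "A \<noteq> {}" unfolding P(1) S_def using G_tuples by blast
  qed (rule that)
  have "S (\<lambda>_. True) \<in> S ` T" unfolding T_def by (simp add: dfn_True)
  then have "eventually (\<lambda>y. y \<in> S (\<lambda>_. True)) W" by (rule W(2))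
  then have Wt: "eventually (\<lambda>y. y \<in> tuples U n) W" unfolding S_def by simp
  have xst: "xs ! j \<in> tuples U n" if "j < ?N" for j using Xt[of j] Xj[OF that] by simp
  have "set (concat xs) \<subseteq> fst U"
    using xst by (force simp: in_set_conv_nth dest: tuplesD(2))
  then have "small (M \<union> set (concat xs))" by (intro small_Un small_M small_set)
  then obtain y where y: "realizes_ultra U n W (M \<union> set (concat xs)) y" using realizes_ultra_exists W(1) Wt by blast
  have yt: "y \<in> tuples U n" using y unfolding realizes_ultra_def by blast
  have et: "x @ e \<in> tuples U (n + n)"
    using e Xt[of 0] G_tuples unfolding X0 wide_over_def by (blast intro: tuples_appendI)
  have pos: "P (xs ! j @ y)" if P: "dfn U M (n + n) P" "P (x @ e)" and j: "j < ?N" for P j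
  proof -
    have "S P \<in> S ` T" unfolding T_def using P by blast
    then have "eventually (\<lambda>y. y \<in> S P) W" by (rule W(2))
    then have "eventually (\<lambda>y. P (xs ! j @ y)) W"
      by (rule eventually_mono) (use j Xj in \<open>auto simp: S_def\<close>)
    moreover have "set (xs ! j) \<subseteq> M \<union> set (concat xs)" using j by auto
    then have "dfn U (M \<union> set (concat xs)) n (\<lambda>y. P (xs ! j @ y))"
      by (rule dfn_const_left[OF xst[OF j]]) (auto intro: dfn_mono[OF P(1)])
    ultimately show ?thesis using y unfolding realizes_ultra_def by blast
  qed
  show ?thesis
  proof (rule that[OF yt])
    fix j assume j: "j < ?N"
    have "P (xs ! j @ y) = P (x @ e)" if P: "dfn U M (n + n) P" for P
      using pos[OF P _ j] pos[OF dfn_not[OF P] _ j] by blast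
    then show "same_type U M (n + n) (xs ! j @ y) (x @ e)"
      unfolding same_type_def using tuples_appendI[OF xst[OF j] yt] et by blast
  qed
qed

text \<open>If the claim fails, one builds an order: alternately choose \<open>x\<^sub>k\<close> in the coheir over everything so far and,
  by amalgamation, \<open>e\<^sub>k\<close> such that \<open>(x\<^sub>j, e\<^sub>k)\<close> has the type of \<open>(x, e)\<close> for all \<open>j \<le> k\<close>; for \<open>j > k\<close> the pair has
  the type of \<open>(d, e)\<close>.\<close>
lemma thin_meet_stationary:
  assumes V: "ultra V" "eventually (\<lambda>z. set z \<subseteq> M) V" "eventually (\<lambda>z. z \<in> tuples U n) V"
    and x: "realizes_ultra U n V M x" and e: "wide_over (M \<union> set x) e" and d: "realizes_ultra U n V (M \<union> set e) d"
    and P: "dfn U M (n + n) P"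
  shows "thin_meet P x e = thin_meet P d e"
proof -
  \<comment> \<open>Genericity of the next \<open>x'\<close> is required over both components of all
    earlier pairs.\<close>
  define hist :: "('a list \<times> 'a list) list \<Rightarrow> 'a set" where
    "hist ps = (\<Union>p\<in>set ps. set (fst p) \<union> set (snd p))" for ps
  define step where "step ps i \<longleftrightarrow> realizes_ultra U n V (M \<union> hist (take i ps)) (fst (ps ! i)) \<and> snd (ps ! i) \<in> tuples U n \<and>
    (\<forall>j\<le>i. same_type U M (n + n) (fst (ps ! j) @ snd (ps ! i)) (x @ e))" for ps i
  define Good where "Good ps \<longleftrightarrow> ps \<noteq> [] \<and> ps ! 0 = (x, e) \<and> (\<forall>i<length ps. step ps i)" for ps
  have xt: "x \<in> tuples U n" using x unfolding realizes_ultra_def by blast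
  have et: "e \<in> tuples U n" using e G_tuples unfolding wide_over_def by blast
  have "Good [(x, e)]"
    using x tuples_appendI[OF xt et] et unfolding Good_def step_def hist_def same_type_def by simp
  moreover have "\<exists>p. Good (ps @ [p])" if ps: "Good ps" for ps
  proof -
    have st: "step ps i" if "i < length ps" for i using ps that unfolding Good_def by blast
    have "set (fst p) \<subseteq> fst U" "set (snd p) \<subseteq> fst U" if "p \<in> set ps" for p
      using st that unfolding step_def realizes_ultra_def by (metis in_set_conv_nth tuplesD(2))+
    then have "hist ps \<subseteq> fst U" unfolding hist_def by blast
    moreover have "hist ps = set (concat (map (\<lambda>p. fst p @ snd p) ps))" unfolding hist_def by simp
    ultimately have "small (M \<union> hist ps)" by (metis small_Un small_M small_set)
    then obtain x' where x': "realizes_ultra U n V (M \<union> hist ps) x'" using realizes_ultra_exists V by blast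
    \<comment> \<open>The first components, with \<open>x'\<close> appended, begin a Morley sequence
      in \<open>V\<close>: forgetting the second components only shrinks the parameter sets.\<close>
    let ?xs = "map fst ps @ [x']"
    obtain y where y: "y \<in> tuples U n" "\<And>j. j < length ?xs \<Longrightarrow> same_type U M (n + n) (?xs ! j @ y) (x @ e)"
    proof (rule wide_amalgamation[OF V, of ?xs])
      fix i assume i: "i < length ?xs"
      show "realizes_ultra U n V (M \<union> (\<Union>y\<in>set (take i ?xs). set y)) (?xs ! i)"
      proof (cases "i < length ps")
        case True
        then show ?thesis using st[OF True] unfolding step_def hist_def
          by (auto simp: nth_append take_map intro: realizes_ultra_mono)
      next
        case False
        then have "i = length ps" using i by simp
        then show ?thesis using x' unfolding hist_def
          by (auto simp: nth_append intro: realizes_ultra_mono)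
      qed
    next
      show "?xs ! 0 = x" using ps unfolding Good_def by (simp add: nth_append)
      show "wide_over (M \<union> set x) e" by (rule e)
    next
      fix y assume "y \<in> tuples U n" "\<And>j. j < length ?xs \<Longrightarrow> same_type U M (n + n) (?xs ! j @ y) (x @ e)"
      then show thesis by (rule that)
    qed simp
    have "step (ps @ [(x', y)]) i" if "i < length (ps @ [(x', y)])" for i
    proof (cases "i < length ps")
      case True
      then have "\<And>j. j \<le> i \<Longrightarrow> (ps @ [(x', y)]) ! j = ps ! j" by (simp add: nth_append)
      then show ?thesis using st[OF True] True unfolding step_def by (simp add: nth_append)
    next
      case False
      then have i: "i = length ps" using that by simp
      have "same_type U M (n + n) (fst ((ps @ [(x', y)]) ! j) @ y) (x @ e)" if "j \<le> i" for j
        using y(2)[of j] that i by (auto simp: nth_append split: if_splits)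
      then show ?thesis unfolding step_def using i x' y(1) by simp
    qed
    then have "Good (ps @ [(x', y)])" using ps unfolding Good_def by (auto simp: nth_append)
    then show ?thesis ..
  qed
  ultimately obtain f where f: "map f [0..<length [(x, e)]] = [(x, e)]"
    "\<And>i. length [(x, e)] \<le> i \<Longrightarrow> Good (map f [0..<i])"
    by (rule dependent_list_choice[of Good "[(x, e)]"]) (assumption, rule that)
  have f0: "f 0 = (x, e)" using f(1) by simp
  have st: "realizes_ultra U n V (M \<union> (\<Union>j<i. set (fst (f j)) \<union> set (snd (f j)))) (fst (f i))"
    "snd (f i) \<in> tuples U n" "\<And>j. j \<le> i \<Longrightarrow> same_type U M (n + n) (fst (f j) @ snd (f i)) (x @ e)" for i
  proof -
    have "step (map f [0..<Suc i]) i" using f(2)[of "Suc i"] unfolding Good_def by (simp del: upt_Suc)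
    moreover have "hist (take i (map f [0..<Suc i])) = (\<Union>j<i. set (fst (f j)) \<union> set (snd (f j)))"
      unfolding hist_def by (simp add: take_map lessThan_atLeast0 del: upt_Suc)
    ultimately show "realizes_ultra U n V (M \<union> (\<Union>j<i. set (fst (f j)) \<union> set (snd (f j)))) (fst (f i))"
      "snd (f i) \<in> tuples U n" "\<And>j. j \<le> i \<Longrightarrow> same_type U M (n + n) (fst (f j) @ snd (f i)) (x @ e)"
      unfolding step_def by (simp_all del: upt_Suc)
  qed
  have ft: "fst (f i) \<in> tuples U n" for i using st(1) unfolding realizes_ultra_def by blast
  have dt: "d \<in> tuples U n" using d unfolding realizes_ultra_def by blast
  \<comment> \<open>\<open>fst (f j)\<close> realizes \<open>V\<close> over
    \<open>snd (f k)\<close>, and \<open>V\<close> lives on tuples \<open>z\<close> from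
    \<open>M\<close>, for which \<open>Q (z @ u)\<close> is a condition on \<open>u\<close> over
    \<open>M\<close>. So only the type of \<open>snd (f k)\<close> over \<open>M\<close> matters,
    and comparison with \<open>f 0 = (x, e)\<close> shows that it is the type of
    \<open>e\<close>.\<close>
  have gt: "same_type U M (n + n) (fst (f j) @ snd (f k)) (d @ e)" if kj: "k < j" for j k
  proof -
    have "Q (fst (f j) @ snd (f k)) = Q (d @ e)" if Q: "dfn U M (n + n) Q" for Q
    proof -
      let ?C = "M \<union> (\<Union>i<j. set (fst (f i)) \<union> set (snd (f i)))"
      have "dfn U ?C n (\<lambda>z. Q (z @ snd (f k)))"
        using kj by (intro dfn_const[OF st(2)] dfn_mono[OF Q]) auto
      then have "Q (fst (f j) @ snd (f k)) = eventually (\<lambda>z. Q (z @ snd (f k))) V"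
        using st(1)[of j] unfolding realizes_ultra_def by blast
      also have "\<dots> = eventually (\<lambda>z. Q (z @ e)) V"
      proof (rule eventually_subst)
        show "eventually (\<lambda>z. Q (z @ snd (f k)) = Q (z @ e)) V"
          using V(2,3)
        proof eventually_elim
          case (elim z)
          have "dfn U M n (\<lambda>u. Q (z @ u))" by (rule dfn_const_left[OF elim(2,1) Q])
          from dfn_coord[OF this coord_take_drop[of n n "n + n"]]
          have "Q (z @ take n (drop n (fst (f 0) @ snd (f k)))) = Q (z @ take n (drop n (x @ e)))"
            using st(3)[of 0 k] unfolding same_type_def by blast
          then show ?case using tuplesD(1)[OF xt] tuplesD(1)[OF et] tuplesD(1)[OF st(2)[of k]] f0 by simp
        qed
      qed
      also have "\<dots> = Q (d @ e)"
      proof -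
        have "dfn U (M \<union> set e) n (\<lambda>z. Q (z @ e))"
          by (intro dfn_const[OF et] dfn_mono[OF Q]) auto
        then show ?thesis using d unfolding realizes_ultra_def by blast
      qed
      finally show ?thesis .
    qed
    then show ?thesis unfolding same_type_def using tuples_appendI[OF ft st(2)] tuples_appendI[OF dt et] by blast
  qed
  show ?thesis by (rule thin_meet_stable[OF P ft st(2) st(3) gt xt dt])
qed

section \<open>Thinness of points\<close>

lemma dfn_notin:
  "finite A \<Longrightarrow> (\<And>z. z \<in> A \<Longrightarrow> z \<in> tuples U k \<and> set z \<subseteq> C) \<Longrightarrow> dfn U C k (\<lambda>a. a \<notin> A)"
proof (induction A rule: finite_induct)
  case empty
  then show ?case by (simp add: dfn_True)
next
  case (insert z A)
  have "dfn U C k (\<lambda>a. \<not> a = z \<and> a \<notin> A)"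
    using insert.prems by (intro dfn_conj dfn_not dfn_eq_tuple insert.IH) (auto dest: tuplesD(1))
  then show ?case by (rule dfn_cong) auto
qed

text \<open>If there were finitely many such points, one formula over \<open>M\<close> would exclude
  them all; it holds at some point of \<open>G\<close>, hence by elementarity at a point from
  \<open>M\<close>.\<close>

lemma infinite_group_M: "infinite {z \<in> G. set z \<subseteq> M}"
proof
  assume fin: "finite {z \<in> G. set z \<subseteq> M}"
  have "dfn U M n (\<lambda>z. z \<in> G \<and> z \<notin> {z \<in> G. set z \<subseteq> M})"
    by (intro dfn_conj dfn_G dfn_notin[OF fin]) (auto intro: G_tuples)
  moreover obtain g where "g \<in> G" "g \<notin> {z \<in> G. set z \<subseteq> M}"
    using infG fin by (metis (no_types, lifting) finite_subset subsetI)
  ultimately obtain z where "set z \<subseteq> M" "z \<in> G \<and> z \<notin> {z \<in> G. set z \<subseteq> M}"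
    using elem_sub_witness[OF elem _ G_tuples] by (metis (no_types, lifting))
  then show False by blast
qed

text \<open>Distinct terms of an indiscernible sequence have disjoint singletons, so primality makes
  one singleton thin, and translation reaches all others. This lets chosen points be discarded,
  which keeps the IP enumeration injective.\<close>

lemma singleton_I:
  assumes "g \<in> G"
  shows "{x \<in> G. x = g} \<in> I"
proof -
  let ?GM = "{z \<in> G. set z \<subseteq> M}"
  \<comment> \<open>The base consists of the cofinite subsets of the group points from
    \<open>M\<close>, so \<open>V\<close> is nonprincipal.\<close>
  obtain V where V: "ultra V" "\<And>A. A \<in> (\<lambda>A. ?GM - A) ` {A. finite A} \<Longrightarrow> eventually (\<lambda>x. x \<in> A) V"
  proof (rule ultra_base[of "(\<lambda>A. ?GM - A) ` {A. finite A}"])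
    show "A \<noteq> {}" if "A \<in> (\<lambda>A. ?GM - A) ` {A. finite A}" for A
      using that infinite_group_M by (metis (no_types, lifting) Diff_infinite_finite finite.emptyI imageE mem_Collect_eq)
    fix A B assume "A \<in> (\<lambda>A. ?GM - A) ` {A. finite A}" "B \<in> (\<lambda>A. ?GM - A) ` {A. finite A}"
    then obtain A' B' where "A = ?GM - A'" "B = ?GM - B'" "finite A'" "finite B'" by blast
    then show "\<exists>C\<in>(\<lambda>A. ?GM - A) ` {A. finite A}. C \<subseteq> A \<inter> B"
      by (intro bexI[of _ "?GM - (A' \<union> B')"]) auto
  qed blast+
  have ev: "eventually (\<lambda>z. z \<in> ?GM \<and> z \<noteq> c) V" for c
    using V(2)[of "?GM - {c}"] by auto
  have V1: "eventually (\<lambda>z. set z \<subseteq> M) V" "eventually (\<lambda>z. z \<in> tuples U n) V" "eventually (\<lambda>z. z \<in> G) V"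
    using ev[of "[]"] by (rule eventually_mono, use G_tuples in blast)+
  obtain X where X: "morley U n V M X" using morley_extend[OF small_M V(1) V1(2), of "[]"] by auto
  have Xt: "X i \<in> tuples U n" for i by (rule morley_tuples[OF X])
  have X0: "X 0 \<in> G" using X V1(3) dfn_G unfolding morley_def realizes_ultra_def by blast
  have "dfn U (M \<union> (\<Union>j<1. set (X j))) n (\<lambda>z. z = X 0)"
    by (rule dfn_eq_tuple) (use tuplesD(1)[OF Xt] in auto)
  then have "(X 1 = X 0) = eventually (\<lambda>z. z = X 0) V"
    using X unfolding morley_def realizes_ultra_def by blast
  moreover have "eventually (\<lambda>z. \<not> z = X 0) V" using ev[of "X 0"] by (rule eventually_mono) blast
  ultimately have ne: "X 1 \<noteq> X 0" using ultra_not[OF V(1)] by blast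
  let ?P = "\<lambda>a. \<forall>i<n. a ! i = a ! (n + i)"
  have P: "dfn U M (n + n) ?P"
  proof (rule dfn_all_less)
    fix j assume "j < n"
    then show "dfn U M (n + n) (\<lambda>a. a ! j = a ! (n + j))"
      by (intro dfnI[of "Eq j (n + j)" _ "[]"]) auto
  qed
  have eq: "?P (x @ X i) \<longleftrightarrow> x = X i" if "x \<in> G" for x i
    using tuplesD(1)[OF G_tuples[OF that]] tuplesD(1)[OF Xt[of i]] by (auto simp: nth_append list_eq_iff_nth_eq)
  have "{x \<in> G. ?P (x @ X 0)} \<in> I"
  proof (rule ccontr)
    assume "{x \<in> G. ?P (x @ X 0)} \<notin> I"
    then have "{x \<in> G. \<forall>j<2::nat. ?P (x @ X j)} \<noteq> {}"
      by (intro notin_I_nonempty prime_morley[OF V(1) V1(1,2) X M_sub P])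
    then obtain x where "x \<in> G" "\<forall>j<2::nat. x = X j" using eq by blast
    then have "x = X 0" "x = X 1" by auto
    then show False using ne by simp
  qed
  moreover have "{x \<in> G. ?P (x @ X 0)} = {x \<in> G. x = X 0}" using eq by blast
  ultimately have "{x \<in> G. x = X 0} \<in> I" by simp
  \<comment> \<open>The translating element is the one that carries \<open>g\<close> to
    \<open>X 0\<close>.\<close>
  then have 1: "{x \<in> G. (X 0 \<otimes>\<^bsub>Gr\<^esub> inv\<^bsub>Gr\<^esub> g) \<otimes>\<^bsub>Gr\<^esub> x = X 0} \<in> I"
    using I_translate[of "X 0 \<otimes>\<^bsub>Gr\<^esub> inv\<^bsub>Gr\<^esub> g" "\<lambda>x. x = X 0"] X0 assms by simp
  have *: "(X 0 \<otimes>\<^bsub>Gr\<^esub> inv\<^bsub>Gr\<^esub> g) \<otimes>\<^bsub>Gr\<^esub> x = X 0 \<longleftrightarrow> x = g" if "x \<in> G" for x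
  proof -
    have "(X 0 \<otimes>\<^bsub>Gr\<^esub> inv\<^bsub>Gr\<^esub> g) \<otimes>\<^bsub>Gr\<^esub> g = X 0" using X0 assms by (simp add: m_assoc)
    then show ?thesis using X0 assms that by (metis Units_eq Units_l_cancel inv_closed m_closed)
  qed
  from * have 2: "{x \<in> G. (X 0 \<otimes>\<^bsub>Gr\<^esub> inv\<^bsub>Gr\<^esub> g) \<otimes>\<^bsub>Gr\<^esub> x = X 0} = {x \<in> G. x = g}" by blast
  show ?thesis using 1 unfolding 2 .
qed

subsection \<open>Shifts and IP sets\<close>

text \<open>Pulling back along left multiplication by \<open>b\<close> turns a set over
  \<open>M \<union> set a\<close> into one over \<open>C \<union> set b\<close>, where wideness of
  \<open>e\<close> applies, and leaves membership in the ideal unchanged.\<close>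

lemma wide_over_translate:
  assumes e: "wide_over (C \<union> set b) e" and b: "b \<in> G" and C: "set a \<subseteq> C \<union> set b" "M \<subseteq> C"
  shows "wide_over (M \<union> set a) (b \<otimes>\<^bsub>Gr\<^esub> e)"
proof -
  have eG: "e \<in> G" using e unfolding wide_over_def by blast
  have "{x \<in> G. P x} \<notin> I" if P: "dfn U (M \<union> set a) n P" "P (b \<otimes>\<^bsub>Gr\<^esub> e)" for P
  proof -
    have "dfn U (C \<union> set b) n P" by (rule dfn_mono[OF P(1)]) (use C in blast)
    then have "dfn U (C \<union> set b) n (\<lambda>x. x \<in> G \<and> P (b \<otimes>\<^bsub>Gr\<^esub> x))" by (rule dfn_translate[OF _ b]) blast
    then have "{x \<in> G. x \<in> G \<and> P (b \<otimes>\<^bsub>Gr\<^esub> x)} \<notin> I" using e eG P(2) unfolding wide_over_def by blast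
    moreover have "{x \<in> G. x \<in> G \<and> P (b \<otimes>\<^bsub>Gr\<^esub> x)} = {x \<in> G. P (b \<otimes>\<^bsub>Gr\<^esub> x)}" by blast
    ultimately show ?thesis using I_translate[OF b, of P] by simp
  qed
  then show ?thesis using b eG unfolding wide_over_def by blast
qed

text \<open>A global wide type. Realizing it over larger small sets needs no further extension of
  types.\<close>

definition wide_ultra :: "'a list filter \<Rightarrow> bool" where
  "wide_ultra W \<longleftrightarrow> ultra W \<and> eventually (\<lambda>z. z \<in> G) W \<and>
     (\<forall>P. dfn U (fst U) n P \<longrightarrow> eventually P W \<longrightarrow> {x \<in> G. P x} \<notin> I)"

text \<open>The differences of a wide set with thin sets form a filter base: they are nonempty
  because definable subsets of thin sets are thin, and directed because the ideal is closed under
  unions.\<close>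

lemma wide_ultra_exists:
  assumes "dfn U (fst U) n B" "{x \<in> G. B x} \<notin> I"
  obtains W where "wide_ultra W" "eventually B W"
proof -
  let ?B = "{x \<in> G. B x}"
  obtain W where W: "ultra W" "\<And>A. A \<in> (\<lambda>Y. ?B - Y) ` I \<Longrightarrow> eventually (\<lambda>x. x \<in> A) W"
  proof (rule ultra_base[of "(\<lambda>Y. ?B - Y) ` I"])
    show "(\<lambda>Y. ?B - Y) ` I \<noteq> {}" using empty_I by blast
  next
    fix A assume "A \<in> (\<lambda>Y. ?B - Y) ` I"
    then obtain Y where Y: "A = ?B - Y" "Y \<in> I" by blast
    show "A \<noteq> {}"
    proof
      assume "A = {}"
      then have "?B \<subseteq> Y" using Y by blast
      then show False using I_mono[OF Y(2) assms(1)] assms(2) by blast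
    qed
  next
    fix A B' assume "A \<in> (\<lambda>Y. ?B - Y) ` I" "B' \<in> (\<lambda>Y. ?B - Y) ` I"
    then obtain Y Z where *: "A = ?B - Y" "B' = ?B - Z" "Y \<in> I" "Z \<in> I" by blast
    then have "Y \<union> Z \<in> I" using ideal unfolding is_ideal_def by blast
    moreover have "?B - (Y \<union> Z) \<subseteq> A \<inter> B'" using * by blast
    ultimately show "\<exists>C\<in>(\<lambda>Y. ?B - Y) ` I. C \<subseteq> A \<inter> B'" by blast
  qed (rule that)
  have ev: "eventually (\<lambda>x. x \<in> ?B - Y) W" if "Y \<in> I" for Y using that by (intro W(2)) blast
  have "{x \<in> G. P x} \<notin> I" if P: "eventually P W" for P
  proof
    assume "{x \<in> G. P x} \<in> I"
    then have "eventually (\<lambda>x. x \<in> ?B - {x \<in> G. P x}) W" by (rule ev)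
    with P have "eventually (\<lambda>x. False) W" by eventually_elim blast
    then show False using ultra_happens[OF W(1)] by blast
  qed
  moreover have "eventually (\<lambda>z. z \<in> G) W" "eventually B W"
    using ev[OF empty_I] by (rule eventually_mono, blast)+
  ultimately show ?thesis using that[of W] W(1) unfolding wide_ultra_def by blast
qed

text \<open>Elementarity puts points from \<open>M\<close> into every \<open>M\<close>-definable set
  of \<open>W\<close>; any ultrafilter containing these traces agrees with \<open>W\<close> over
  \<open>M\<close>.\<close>

lemma coheir_exists:
  assumes W: "ultra W" "eventually (\<lambda>z. z \<in> tuples U n) W"
  obtains V where "ultra V" "eventually (\<lambda>z. set z \<subseteq> M) V" "eventually (\<lambda>z. z \<in> tuples U n) V"
    "\<And>a. realizes_ultra U n W M a \<Longrightarrow> realizes_ultra U n V M a"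
proof -
  define T where "T = {P. dfn U M n P \<and> eventually P W}"
  define S where "S P = {z \<in> tuples U n. set z \<subseteq> M \<and> P z}" for P
  have True_T: "(\<lambda>_. True) \<in> T" unfolding T_def by (simp add: dfn_True)
  obtain V where V: "ultra V" "\<And>A. A \<in> S ` T \<Longrightarrow> eventually (\<lambda>x. x \<in> A) V"
  proof (rule ultra_base[of "S ` T"])
    show "S ` T \<noteq> {}" using True_T by blast
  next
    fix A B assume "A \<in> S ` T" "B \<in> S ` T"
    then obtain P Q where *: "A = S P" "B = S Q" "P \<in> T" "Q \<in> T" by blast
    then have "(\<lambda>a. P a \<and> Q a) \<in> T" unfolding T_def by (auto intro: dfn_conj eventually_conj)
    moreover have "S (\<lambda>a. P a \<and> Q a) \<subseteq> A \<inter> B" unfolding * S_def by blast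
    ultimately show "\<exists>C\<in>S ` T. C \<subseteq> A \<inter> B" by blast
  next
    fix A assume "A \<in> S ` T"
    then obtain P where P: "A = S P" "dfn U M n P" "eventually P W" unfolding T_def by blast
    have "eventually (\<lambda>z. z \<in> tuples U n \<and> P z) W" by (rule eventually_conj[OF W(2) P(3)])
    then obtain a where a: "a \<in> tuples U n" "P a" using ultra_happens[OF W(1)] by blast
    obtain z where "z \<in> tuples U n" "set z \<subseteq> M" "P z" by (rule elem_sub_witness[OF elem P(2) a]) (rule that)
    then show "A \<noteq> {}" unfolding P(1) S_def by blast
  qed (rule that)
  have ev: "eventually (\<lambda>z. z \<in> tuples U n \<and> set z \<subseteq> M \<and> P z) V" if "dfn U M n P" "eventually P W" for P
  proof -
    have "S P \<in> S ` T" using that unfolding T_def by blast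
    then have "eventually (\<lambda>z. z \<in> S P) V" by (rule V(2))
    then show ?thesis unfolding S_def by simp
  qed
  have same: "eventually P V = eventually P W" if P: "dfn U M n P" for P
  proof (cases "eventually P W")
    case True
    have "eventually P V" using ev[OF P True] by (rule eventually_mono) blast
    then show ?thesis using True by simp
  next
    case False
    then have "eventually (\<lambda>z. \<not> P z) W" using ultra_not[OF W(1)] by blast
    from ev[OF dfn_not[OF P] this] have "eventually (\<lambda>z. \<not> P z) V" by (rule eventually_mono) blast
    then show ?thesis using False ultra_not[OF V(1)] by blast
  qed
  have "eventually (\<lambda>z. True) W" by simp
  from ev[OF dfn_True this] have "eventually (\<lambda>z. set z \<subseteq> M) V" "eventually (\<lambda>z. z \<in> tuples U n) V"
    by (auto elim: eventually_mono)
  moreover have "realizes_ultra U n V M a" if "realizes_ultra U n W M a" for a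
    using that same unfolding realizes_ultra_def by blast
  ultimately show ?thesis using that V(1) by blast
qed

lemma wide_shift:
  assumes B: "dfn U M n B" "{x \<in> G. B x} \<notin> I"
    and np: "\<And>W. wide_ultra W \<Longrightarrow> eventually B W \<Longrightarrow>
      \<exists>a b c. realizes_ultra U n W M a \<and> realizes_ultra U n W M b \<and> realizes_ultra U n W M c \<and> a = b \<otimes>\<^bsub>Gr\<^esub> c"
  obtains z where "z \<in> G" "set z \<subseteq> M" "B z" "{x \<in> G. B x \<and> B (z \<otimes>\<^bsub>Gr\<^esub> x)} \<notin> I"
proof -
  obtain W where W: "wide_ultra W" "eventually B W"
    by (rule wide_ultra_exists[OF dfn_mono[OF B(1) M_sub] B(2)]) (rule that)
  have Wu: "ultra W" and WG: "eventually (\<lambda>z. z \<in> G) W" using W(1) unfolding wide_ultra_def by auto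
  have Wt: "eventually (\<lambda>z. z \<in> tuples U n) W" using WG by (rule eventually_mono) (rule G_tuples)
  obtain a b c where abc: "realizes_ultra U n W M a" "realizes_ultra U n W M b" "realizes_ultra U n W M c" "a = b \<otimes>\<^bsub>Gr\<^esub> c"
    using np[OF W] by blast
  have rG: "z \<in> G" if "realizes_ultra U n W C z" for z C using that dfn_G WG unfolding realizes_ultra_def by blast
  have G: "a \<in> G" "b \<in> G" "c \<in> G" using abc rG by blast+
  have setU: "set a \<subseteq> fst U" "set b \<subseteq> fst U" "set c \<subseteq> fst U" using G by (auto dest: G_tuples tuplesD(2))
  let ?C = "M \<union> set a \<union> set b \<union> set c"
  have C: "small ?C" by (intro small_Un small_M small_set setU)
  obtain e where e: "realizes_ultra U n W ?C e" using realizes_ultra_exists[OF C Wu Wt] by blast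
  have eG: "e \<in> G" by (rule rG[OF e])
  have eB: "B e" using e W(2) dfn_mono[OF B(1), of ?C] unfolding realizes_ultra_def by blast
  have ew: "wide_over ?C e"
    using e eG W(1) dfn_mono[OF _ small_sub[OF C]] unfolding wide_over_def wide_ultra_def realizes_ultra_def by blast
  obtain V where V: "ultra V" "eventually (\<lambda>z. set z \<subseteq> M) V" "eventually (\<lambda>z. z \<in> tuples U n) V"
    "\<And>a. realizes_ultra U n W M a \<Longrightarrow> realizes_ultra U n V M a" by (rule coheir_exists[OF Wu Wt]) (rule that)
  \<comment> \<open>\<open>P (x @ g)\<close> expresses that \<open>x\<close> lies in
    \<open>g B\<close>, the form that \<open>thin_meet\<close> expects.\<close>
  define P where "P = (\<lambda>a. take n a \<in> G \<and> drop n a \<in> G \<and> B (inv\<^bsub>Gr\<^esub> (drop n a) \<otimes>\<^bsub>Gr\<^esub> take n a))"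
  have P: "dfn U M (n + n) P" unfolding P_def by (rule dfn_coset[OF B(1)])
  have Peq: "P (x @ g) \<longleftrightarrow> B (inv\<^bsub>Gr\<^esub> g \<otimes>\<^bsub>Gr\<^esub> x)" if "x \<in> G" "g \<in> G" for x g
    unfolding P_def using that tuplesD(1)[OF G_tuples[OF that(1)]] by simp
  have meetG: "thin_meet P g h \<longleftrightarrow> {x \<in> G. B (inv\<^bsub>Gr\<^esub> g \<otimes>\<^bsub>Gr\<^esub> x) \<and> B (inv\<^bsub>Gr\<^esub> h \<otimes>\<^bsub>Gr\<^esub> x)} \<in> I" if "g \<in> G" "h \<in> G" for g h
  proof -
    have "{x \<in> G. P (x @ g) \<and> P (x @ h)} = {x \<in> G. B (inv\<^bsub>Gr\<^esub> g \<otimes>\<^bsub>Gr\<^esub> x) \<and> B (inv\<^bsub>Gr\<^esub> h \<otimes>\<^bsub>Gr\<^esub> x)}"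
      using Peq that by blast
    then show ?thesis unfolding thin_meet_def by simp
  qed
  have small_d: "small (M \<union> set g)" if "g \<in> G" for g
    using that by (intro small_Un small_M small_set) (auto dest: G_tuples tuplesD(2))

  obtain d where d: "realizes_ultra U n V (M \<union> set e) d" using realizes_ultra_exists[OF small_d[OF eG] V(1,3)] by blast
  have eV: "realizes_ultra U n V M e" by (rule V(4)[OF realizes_ultra_mono[OF e]]) blast
  \<comment> \<open>\<open>e\<close> realizes \<open>V\<close> over \<open>M\<close> and
    \<open>d\<close> realizes it over \<open>M\<close> and \<open>e\<close>, so they open a Morley
    sequence; the translate of \<open>B\<close> by \<open>e\<close> is wide, and primality
    applies.\<close>
  have "\<not> thin_meet P e d"
  proof -
    obtain X where X: "morley U n V M X" "map X [0..<length [e, d]] = [e, d]"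
    proof (rule morley_extend[OF small_M V(1,3), of "[e, d]"])
      fix i assume "i < length [e, d]"
      then have "i = 0 \<or> i = 1" by auto
      then show "realizes_ultra U n V (M \<union> (\<Union>y\<in>set (take i [e, d]). set y)) ([e, d] ! i)" using eV d by auto
    qed (rule that)
    have X01: "X 0 = e" "X 1 = d" using X(2) by (auto simp: upt_rec)
    have "{x \<in> G. P (x @ X 0)} = {x \<in> G. B (inv\<^bsub>Gr\<^esub> e \<otimes>\<^bsub>Gr\<^esub> x)}" unfolding X01 using Peq eG by blast
    moreover have "{x \<in> G. B (inv\<^bsub>Gr\<^esub> e \<otimes>\<^bsub>Gr\<^esub> x)} \<notin> I"
      using B(2) I_translate[OF inv_closed[OF eG], of B] by simp
    ultimately have "{x \<in> G. P (x @ X 0)} \<notin> I" by simp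
    then have "{x \<in> G. \<forall>j<2::nat. P (x @ X j)} \<notin> I"
      by (rule prime_morley[OF V(1-3) X(1) M_sub P])
    moreover have "(\<forall>j<2::nat. P (x @ X j)) \<longleftrightarrow> P (x @ e) \<and> P (x @ d)" for x
      unfolding X01[symmetric] by (auto simp: numeral_2_eq_2 less_Suc_eq)
    ultimately show ?thesis unfolding thin_meet_def by simp
  qed
  \<comment> \<open>Here \<open>d\<close> is generic over \<open>e\<close>, whereas \<open>e\<close>
    is wide over \<open>c\<close>; stationarity bridges the two situations.\<close>
  moreover have "thin_meet P c e = thin_meet P d e"
    by (rule thin_meet_stationary[OF V(1-3) V(4)[OF abc(3)] wide_over_mono[OF ew] d P]) blast
  ultimately have "\<not> thin_meet P c e" using thin_meet_commute by blast

  define f where "f = b \<otimes>\<^bsub>Gr\<^esub> e"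
  have fG: "f \<in> G" unfolding f_def using G eG by simp
  have "{x \<in> G. B (inv\<^bsub>Gr\<^esub> a \<otimes>\<^bsub>Gr\<^esub> (b \<otimes>\<^bsub>Gr\<^esub> x)) \<and> B (inv\<^bsub>Gr\<^esub> f \<otimes>\<^bsub>Gr\<^esub> (b \<otimes>\<^bsub>Gr\<^esub> x))} =
      {x \<in> G. B (inv\<^bsub>Gr\<^esub> c \<otimes>\<^bsub>Gr\<^esub> x) \<and> B (inv\<^bsub>Gr\<^esub> e \<otimes>\<^bsub>Gr\<^esub> x)}"
  proof -
    have "inv\<^bsub>Gr\<^esub> (b \<otimes>\<^bsub>Gr\<^esub> u) \<otimes>\<^bsub>Gr\<^esub> (b \<otimes>\<^bsub>Gr\<^esub> x) = inv\<^bsub>Gr\<^esub> u \<otimes>\<^bsub>Gr\<^esub> x" if "u \<in> G" "x \<in> G" for u x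
    proof -
      have "inv\<^bsub>Gr\<^esub> b \<otimes>\<^bsub>Gr\<^esub> (b \<otimes>\<^bsub>Gr\<^esub> x) = x" using that G(2) by (simp add: m_assoc[symmetric])
      then show ?thesis using that G(2) by (simp add: inv_mult_group m_assoc)
    qed
    then show ?thesis unfolding abc(4) f_def using G eG by auto
  qed
  then have "thin_meet P a f = thin_meet P c e"
    using meetG[OF G(1) fG] meetG[OF G(3) eG]
      I_translate[OF G(2), of "\<lambda>x. B (inv\<^bsub>Gr\<^esub> a \<otimes>\<^bsub>Gr\<^esub> x) \<and> B (inv\<^bsub>Gr\<^esub> f \<otimes>\<^bsub>Gr\<^esub> x)"] by simp
  \<comment> \<open>Stationarity compares both sides with one auxiliary realization
    \<open>d'\<close> of \<open>V\<close> over \<open>f\<close>.\<close>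
  moreover have "thin_meet P a f = thin_meet P b f"
  proof -
    obtain d' where d': "realizes_ultra U n V (M \<union> set f) d'" using realizes_ultra_exists[OF small_d[OF fG] V(1,3)] by blast
    have ew': "wide_over (?C \<union> set b) e" by (rule wide_over_mono[OF ew]) blast
    have "wide_over (M \<union> set a) f" "wide_over (M \<union> set b) f"
      unfolding f_def by (rule wide_over_translate[OF ew' G(2)]; blast)+
    then show ?thesis
      using thin_meet_stationary[OF V(1-3) V(4)[OF abc(1)] _ d' P] thin_meet_stationary[OF V(1-3) V(4)[OF abc(2)] _ d' P] by blast
  qed
  ultimately have "\<not> thin_meet P b f" using \<open>\<not> thin_meet P c e\<close> by blast
  \<comment> \<open>Translating back by \<open>f\<close> instead of \<open>b\<close> produces the
    preimage of \<open>B\<close> under multiplication by \<open>e\<close>, the form that the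
    iteration uses.\<close>
  moreover have "thin_meet P b f \<longleftrightarrow> {x \<in> G. B x \<and> B (e \<otimes>\<^bsub>Gr\<^esub> x)} \<in> I"
  proof -
    have "inv\<^bsub>Gr\<^esub> b \<otimes>\<^bsub>Gr\<^esub> (f \<otimes>\<^bsub>Gr\<^esub> x) = e \<otimes>\<^bsub>Gr\<^esub> x" if "x \<in> G" for x
      using that G(2) eG unfolding f_def by (simp add: m_assoc[symmetric])
    moreover have "inv\<^bsub>Gr\<^esub> f \<otimes>\<^bsub>Gr\<^esub> (f \<otimes>\<^bsub>Gr\<^esub> x) = x" if "x \<in> G" for x
      using that fG by (simp add: m_assoc[symmetric])
    ultimately have "{x \<in> G. B (inv\<^bsub>Gr\<^esub> b \<otimes>\<^bsub>Gr\<^esub> (f \<otimes>\<^bsub>Gr\<^esub> x)) \<and> B (inv\<^bsub>Gr\<^esub> f \<otimes>\<^bsub>Gr\<^esub> (f \<otimes>\<^bsub>Gr\<^esub> x))} =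
        {x \<in> G. B x \<and> B (e \<otimes>\<^bsub>Gr\<^esub> x)}" by auto
    then show ?thesis
      using meetG[OF G(2) fG] I_translate[OF fG, of "\<lambda>x. B (inv\<^bsub>Gr\<^esub> b \<otimes>\<^bsub>Gr\<^esub> x) \<and> B (inv\<^bsub>Gr\<^esub> f \<otimes>\<^bsub>Gr\<^esub> x)"] by simp
  qed
  ultimately have eI: "{x \<in> G. B x \<and> B (e \<otimes>\<^bsub>Gr\<^esub> x)} \<notin> I" by blast

  have swap: "dfn U M (n + n) (\<lambda>a. P' (drop n a) (take n a))" if "dfn U M (n + n) (\<lambda>a. P' (take n a) (drop n a))" for P'
    by (rule dfn_cong[OF dfn_swap[OF that]]) (auto dest!: tuplesD(1))
  have "dfn U M (n + n) (\<lambda>a. drop n a \<in> G \<and> take n a \<in> G \<and> B (drop n a \<otimes>\<^bsub>Gr\<^esub> take n a))"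
    by (rule swap[of "\<lambda>x y. x \<in> G \<and> y \<in> G \<and> B (x \<otimes>\<^bsub>Gr\<^esub> y)"]) (rule dfn_mult[OF B(1)])
  moreover have "dfn U M (n + n) (\<lambda>a. B (take n (drop 0 a)))"
    by (rule dfn_coord[OF B(1) coord_take_drop]) simp
  ultimately have Q: "dfn U M (n + n) (\<lambda>a. (drop n a \<in> G \<and> take n a \<in> G \<and> B (drop n a \<otimes>\<^bsub>Gr\<^esub> take n a)) \<and> B (take n (drop 0 a)))"
    (is "dfn U M (n + n) ?Q") by (rule dfn_conj)
  have Qeq: "{x \<in> G. ?Q (x @ g)} = {x \<in> G. B x \<and> B (g \<otimes>\<^bsub>Gr\<^esub> x)}" if "g \<in> G" for g
  proof -
    have "?Q (x @ g) \<longleftrightarrow> B x \<and> B (g \<otimes>\<^bsub>Gr\<^esub> x)" if "x \<in> G" for x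
      using that \<open>g \<in> G\<close> tuplesD(1)[OF G_tuples[OF that]] by auto
    then show ?thesis by blast
  qed
  obtain S where S: "\<And>P. P \<in> S \<Longrightarrow> dfn U M n P"
    "\<And>b. b \<in> tuples U n \<Longrightarrow> {x \<in> G. ?Q (x @ b)} \<in> I \<longleftrightarrow> (\<forall>P\<in>S. P b)"
    by (rule I_closed[OF Q M_sub]) (rule that)
  \<comment> \<open>Failure of the single condition \<open>P1\<close> already forces wideness, so
    what has to be reflected into \<open>M\<close> is definable over \<open>M\<close>.\<close>
  obtain P1 where P1: "P1 \<in> S" "\<not> P1 e" using S(2)[OF G_tuples[OF eG]] eI unfolding Qeq[OF eG] by blast
  have "dfn U M n (\<lambda>z. z \<in> G \<and> B z \<and> \<not> P1 z)" by (intro dfn_conj dfn_G B(1) dfn_not S(1) P1(1))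
  then obtain z where z: "z \<in> G \<and> B z \<and> \<not> P1 z" "set z \<subseteq> M"
    by (rule elem_sub_witness[OF elem _ G_tuples[OF eG]]) (use eG eB P1(2) that in auto)
  then have "{x \<in> G. B x \<and> B (z \<otimes>\<^bsub>Gr\<^esub> x)} \<notin> I"
    using S(2)[OF G_tuples, of z] P1(1) Qeq[of z] by metis
  then show ?thesis using that z by blast
qed

text \<open>The product is the unique solution of a formula over \<open>M\<close>, so elementarity
  places it in \<open>M\<close>.\<close>

lemma mult_M:
  assumes "g \<in> G" "h \<in> G" "set g \<subseteq> M" "set h \<subseteq> M"
  shows "set (g \<otimes>\<^bsub>Gr\<^esub> h) \<subseteq> M"
proof -
  have t: "g \<in> tuples U n" "h \<in> tuples U n" "g \<otimes>\<^bsub>Gr\<^esub> h \<in> tuples U n" using assms G_tuples by auto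
  have "dfn U M (n + n) (\<lambda>a. g @ a \<in> graph)" by (rule dfn_const_left[OF t(1) assms(3) dfn_graph])
  then have "dfn U M n (\<lambda>z. g @ (h @ z) \<in> graph)" by (rule dfn_const_left[OF t(2) assms(4)])
  moreover have "g @ (h @ z) \<in> graph \<longleftrightarrow> z = g \<otimes>\<^bsub>Gr\<^esub> h" for z
    using graph_iff[of g h z] tuplesD(1)[OF t(1)] tuplesD(1)[OF t(2)] assms by simp
  ultimately have "dfn U M n (\<lambda>z. z = g \<otimes>\<^bsub>Gr\<^esub> h)" by simp
  then obtain z where "set z \<subseteq> M" "z = g \<otimes>\<^bsub>Gr\<^esub> h"
    by (rule elem_sub_witness[OF elem _ t(3)]) (use that in auto)
  then show ?thesis by simp
qed

lemma IP_set_exists: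
  assumes A: "dfn U M n A" "{x \<in> G. A x} \<notin> I"
    and np: "\<And>W. wide_ultra W \<Longrightarrow> eventually A W \<Longrightarrow>
      \<exists>a b c. realizes_ultra U n W M a \<and> realizes_ultra U n W M b \<and> realizes_ultra U n W M c \<and> a = b \<otimes>\<^bsub>Gr\<^esub> c"
  shows "IP_set Gr {x \<in> G. A x \<and> set x \<subseteq> M}"
proof -
  \<comment> \<open>A state consists of a chosen point and the set it was chosen from;
    \<open>R\<close> makes the next set part of the shifted intersection without that point.\<close>
  define Q where "Q s \<longleftrightarrow> (case s of (z, B) \<Rightarrow> dfn U M n B \<and> (\<forall>x. B x \<longrightarrow> A x) \<and> z \<in> G \<and> set z \<subseteq> M \<and> B z \<and>
    {x \<in> G. B x \<and> B (z \<otimes>\<^bsub>Gr\<^esub> x)} \<notin> I)" for s :: "'a list \<times> ('a list \<Rightarrow> bool)"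
  define R where "R s s' \<longleftrightarrow> (\<forall>x. snd s' x \<longrightarrow> x \<in> G \<and> snd s x \<and> snd s (fst s \<otimes>\<^bsub>Gr\<^esub> x) \<and> x \<noteq> fst s)"
    for s s' :: "'a list \<times> ('a list \<Rightarrow> bool)"
  have start: "\<exists>z. Q (z, B)" if B: "dfn U M n B" "\<And>x. B x \<Longrightarrow> A x" "{x \<in> G. B x} \<notin> I" for B
  proof -
    have "\<exists>a b c. realizes_ultra U n W M a \<and> realizes_ultra U n W M b \<and> realizes_ultra U n W M c \<and> a = b \<otimes>\<^bsub>Gr\<^esub> c"
      if "wide_ultra W" "eventually B W" for W
      using that B(2) by (intro np) (auto elim: eventually_mono)
    then obtain z where "z \<in> G" "set z \<subseteq> M" "B z" "{x \<in> G. B x \<and> B (z \<otimes>\<^bsub>Gr\<^esub> x)} \<notin> I"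
      using wide_shift[OF B(1,3)] by blast
    then show ?thesis using B unfolding Q_def by blast
  qed
  have "\<exists>s. \<forall>k. Q (s k) \<and> R (s k) (s (Suc k))"
  proof (rule dependent_nat_choice)
    show "\<exists>s. Q s" using start[OF A(1) _ A(2)] by blast
  next
    fix s :: "'a list \<times> ('a list \<Rightarrow> bool)" and k :: nat
    assume s: "Q s"
    obtain z B where zB: "s = (z, B)" by (cases s)
    have B: "dfn U M n B" "\<And>x. B x \<Longrightarrow> A x" "z \<in> G" "set z \<subseteq> M" "B z"
      "{x \<in> G. B x \<and> B (z \<otimes>\<^bsub>Gr\<^esub> x)} \<notin> I" using s unfolding Q_def zB by auto
    define B' where "B' x \<longleftrightarrow> (x \<in> G \<and> B (z \<otimes>\<^bsub>Gr\<^esub> x)) \<and> B x \<and> \<not> x = z" for x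
    have dB': "dfn U M n B'" unfolding B'_def
      using tuplesD(1)[OF G_tuples[OF B(3)]]
      by (intro dfn_conj dfn_translate B(1,3,4) dfn_not dfn_eq_tuple)
    \<comment> \<open>Otherwise adding back the thin set containing only \<open>z\<close> would make
      the whole shifted intersection thin.\<close>
    have "{x \<in> G. B' x} \<notin> I"
    proof
      assume "{x \<in> G. B' x} \<in> I"
      then have "{x \<in> G. B' x} \<union> {x \<in> G. x = z} \<in> I"
        using singleton_I[OF B(3)] ideal unfolding is_ideal_def by blast
      moreover have "dfn U (fst U) n (\<lambda>x. B x \<and> (x \<in> G \<and> B (z \<otimes>\<^bsub>Gr\<^esub> x)))"
        using B(4) M_sub by (intro dfn_conj dfn_translate B(3) dfn_mono[OF B(1) M_sub]) auto
      ultimately have "{x \<in> G. B x \<and> (x \<in> G \<and> B (z \<otimes>\<^bsub>Gr\<^esub> x))} \<in> I"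
        by (rule I_mono) (auto simp: B'_def)
      moreover have "{x \<in> G. B x \<and> (x \<in> G \<and> B (z \<otimes>\<^bsub>Gr\<^esub> x))} = {x \<in> G. B x \<and> B (z \<otimes>\<^bsub>Gr\<^esub> x)}" by blast
      ultimately show False using B(6) by simp
    qed
    then obtain z' where "Q (z', B')" using start[OF dB'] B(2) unfolding B'_def by blast
    moreover have "R s (z', B')" unfolding R_def zB B'_def by simp
    ultimately show "\<exists>s'. Q s' \<and> R s s'" by blast
  qed
  then obtain s where s: "\<And>k. Q (s k)" "\<And>k. R (s k) (s (Suc k))" by blast
  define x where "x k = fst (s k)" for k
  define B where "B k = snd (s k)" for k
  have xB: "x k \<in> G" "set (x k) \<subseteq> M" "B k (x k)" "\<And>y. B k y \<Longrightarrow> A y" for k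
    using s(1)[of k] unfolding Q_def x_def B_def by (auto split: prod.splits)
  have BS: "y \<in> G \<and> B k y \<and> B k (x k \<otimes>\<^bsub>Gr\<^esub> y) \<and> y \<noteq> x k" if "B (Suc k) y" for k y
    using s(2)[of k] that unfolding R_def x_def B_def by blast
  have Bmono: "B k y" if "k \<le> l" "B l y" for k l y
    using that by (induction l) (auto simp: le_Suc_eq dest: BS)
  have "inj x"
  proof (rule linorder_injI)
    fix i j :: nat assume "i < j"
    then have "B (Suc i) (x j)" using xB(3)[of j] by (intro Bmono[of "Suc i" j]) auto
    then show "x i \<noteq> x j" using BS[of i "x j"] by auto
  qed
  \<comment> \<open>Induction from the right: the product of the tail lies in the set of its first
    index, hence in \<open>B (Suc i)\<close>, and left multiplication by \<open>x i\<close> then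
    lands in \<open>B i\<close>.\<close>
  have prod: "gprod Gr (map x is) \<in> G \<and> set (gprod Gr (map x is)) \<subseteq> M \<and> B (hd is) (gprod Gr (map x is))"
    if "is \<noteq> []" "sorted_wrt (<) is" for "is"
    using that
  proof (induction "is")
    case (Cons i js)
    show ?case
    proof (cases js)
      case Nil
      then show ?thesis using xB by simp
    next
      case (Cons j js')
      let ?p = "gprod Gr (map x js)"
      have p: "?p \<in> G" "set ?p \<subseteq> M" "B j ?p" using Cons.IH Cons.prems Cons by auto
      have "i < j" using Cons.prems Cons by auto
      then have "B (Suc i) ?p" using p(3) by (intro Bmono[of "Suc i" j]) auto
      then have "B i (x i \<otimes>\<^bsub>Gr\<^esub> ?p)" using BS by blast
      moreover have "gprod Gr (map x (i # js)) = x i \<otimes>\<^bsub>Gr\<^esub> ?p" using Cons by simp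
      moreover have "set (x i \<otimes>\<^bsub>Gr\<^esub> ?p) \<subseteq> M" by (rule mult_M[OF xB(1) p(1) xB(2) p(2)])
      ultimately show ?thesis using xB(1) p(1) by simp
    qed
  qed simp
  show ?thesis unfolding IP_set_def
  proof (intro exI[of _ x] conjI allI impI)
    show "inj x" by fact
    show "range x \<subseteq> {x \<in> G. A x \<and> set x \<subseteq> M}" using xB by blast
    show "gprod Gr (map x is) \<in> {x \<in> G. A x \<and> set x \<subseteq> M}" if "is \<noteq> []" "sorted_wrt (<) is" for "is"
      using prod[OF that] xB(4) by blast
  qed
qed

text \<open>The bridge from types to ultrafilters: the formulas over \<open>M\<close> that are
  \<open>W\<close>-large form a complete wide type through \<open>A\<close>, whose realizations are
  exactly those of \<open>W\<close> over \<open>M\<close>.\<close>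

lemma non_product_free_realizations:
  assumes A: "definable_over U n M A" "A \<subseteq> G"
    and np: "\<And>p. complete_type U M n p \<Longrightarrow> wide_type U n Gr I p \<Longrightarrow> type_contains U n p A
      \<Longrightarrow> \<not> product_free U n Gr p"
    and W: "wide_ultra W" "eventually (\<lambda>z. z \<in> A) W"
  shows "\<exists>a b c. realizes_ultra U n W M a \<and> realizes_ultra U n W M b \<and> realizes_ultra U n W M c \<and> a = b \<otimes>\<^bsub>Gr\<^esub> c"
proof -
  have Wu: "ultra W" and WG: "eventually (\<lambda>z. z \<in> G) W" using W(1) unfolding wide_ultra_def by auto
  have Wt: "eventually (\<lambda>z. z \<in> tuples U n) W" using WG by (rule eventually_mono) (rule G_tuples)
  define p :: "('r fm \<times> 'a list) set" where
    "p = {(\<phi>, bs) \<in> fmls_over M n. eventually (\<lambda>z. sat U (nth (z @ bs)) \<phi>) W}"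
  have dfn_fml: "dfn U M n (\<lambda>z. sat U (nth (z @ bs)) \<phi>)" if "(\<phi>, bs) \<in> fmls_over M n" for \<phi> :: "'r fm" and bs
    using that unfolding fmls_over_def by (intro dfnI[of \<phi> n bs M]) auto
  have dec: "(\<phi>, bs) \<in> p \<or> (Neg \<phi>, bs) \<in> p" if "(\<phi>, bs) \<in> fmls_over M n" for \<phi> bs
    using that ultra_not[OF Wu, of "\<lambda>z. sat U (nth (z @ bs)) \<phi>"] unfolding p_def fmls_over_def by auto
  have realizes_p: "realizes U n a p \<longleftrightarrow> realizes_ultra U n W M a" for a
  proof
    assume a: "realizes_ultra U n W M a"
    show "realizes U n a p" unfolding realizes_def
    proof (intro conjI ballI)
      show "a \<in> tuples U n" using a unfolding realizes_ultra_def by blast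
      fix x assume "x \<in> p"
      then obtain \<phi> bs where x: "x = (\<phi>, bs)" "(\<phi>, bs) \<in> fmls_over M n"
        "eventually (\<lambda>z. sat U (nth (z @ bs)) \<phi>) W" unfolding p_def by blast
      then show "case x of (\<phi>, bs) \<Rightarrow> sat U (nth (a @ bs)) \<phi>"
        using a dfn_fml[OF x(2)] unfolding realizes_ultra_def by simp
    qed
  next
    assume a: "realizes U n a p"
    then have at: "a \<in> tuples U n" unfolding realizes_def by blast
    have "P a = eventually P W" if P: "dfn U M n P" for P
    proof -
      obtain \<phi> bs where 1: "fv \<phi> \<subseteq> {..<n + length bs}" "set bs \<subseteq> M"
        "\<And>a. a \<in> tuples U n \<Longrightarrow> P a \<longleftrightarrow> sat U (nth (a @ bs)) \<phi>" using P by (rule dfnE) blast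
      have f: "(\<phi>, bs) \<in> fmls_over M n" using 1 unfolding fmls_over_def by blast
      have "eventually (\<lambda>z. P z = sat U (nth (z @ bs)) \<phi>) W"
        using Wt by (rule eventually_mono) (rule 1(3))
      then have "eventually P W = eventually (\<lambda>z. sat U (nth (z @ bs)) \<phi>) W" by (rule eventually_subst)
      also have "\<dots> = ((\<phi>, bs) \<in> p)" using f unfolding p_def by blast
      also have "\<dots> = sat U (nth (a @ bs)) \<phi>" using dec[OF f] a unfolding realizes_def by auto
      finally show ?thesis using 1(3)[OF at] by blast
    qed
    then show "realizes_ultra U n W M a" using at unfolding realizes_ultra_def by blast
  qed
  obtain d where "realizes_ultra U n W M d" using realizes_ultra_exists[OF small_M Wu Wt] by blast
  then have "realizes U n d p" using realizes_p by blast
  then have "fin_sat U n p" unfolding fin_sat_def realizes_def by blast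
  moreover have "p \<subseteq> fmls_over M n" unfolding p_def by blast
  ultimately have 1: "complete_type U M n p" using dec unfolding complete_type_def by blast
  have 2: "wide_type U n Gr I p" unfolding wide_type_def
  proof
    fix x assume "x \<in> p"
    then obtain \<phi> bs where x: "x = (\<phi>, bs)" "(\<phi>, bs) \<in> fmls_over M n"
      "eventually (\<lambda>z. sat U (nth (z @ bs)) \<phi>) W" unfolding p_def by blast
    have "{z \<in> G. sat U (nth (z @ bs)) \<phi>} \<notin> I"
      using W(1) x(3) dfn_mono[OF dfn_fml[OF x(2)] M_sub] unfolding wide_ultra_def by blast
    moreover have "inst U n Gr \<phi> bs = {z \<in> G. sat U (nth (z @ bs)) \<phi>}"
      unfolding inst_def defset_def using G_tuples by blast
    ultimately show "case x of (\<phi>, bs) \<Rightarrow> inst U n Gr \<phi> bs \<notin> I" using x(1) by simp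
  qed
  have 3: "type_contains U n p A"
  proof -
    obtain \<phi> bs where f: "(\<phi>, bs) \<in> fmls_over M n" "A = defset U n \<phi> bs"
      using A(1) unfolding definable_over_def by blast
    have "eventually (\<lambda>z. sat U (nth (z @ bs)) \<phi>) W"
      using W(2) by (rule eventually_mono) (simp add: f(2) defset_def)
    then have "(\<phi>, bs) \<in> p" using f unfolding p_def by blast
    then show ?thesis unfolding type_contains_def using f(2) by blast
  qed
  show ?thesis using np[OF 1 2 3] realizes_p unfolding product_free_def by blast
qed

end

theorem mainTheorem8:
  fixes U :: "('a, 'r) struct" and n :: nat and Gr :: "'a list monoid"
    and I :: "'a list set set" and M :: "'a set" and A :: "'a list set"
  assumes "is_structure U"
    and "elem_sub M U"
    and "saturated_over U M"
    and "definable_group U n Gr"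
    and "infinite (carrier Gr)"
    and "is_ideal U n Gr I"
    and "left_invariant Gr I"
    and "indiscernibly_prime U n Gr I"
    and "type_definable_empty U n Gr I"
    and "A \<subseteq> carrier Gr" and "definable_over U n M A" and "A \<notin> I"
    and "\<forall>p. complete_type U M n p \<longrightarrow> wide_type U n Gr I p \<longrightarrow> type_contains U n p A
           \<longrightarrow> \<not> product_free U n Gr p"
  shows "\<exists>S \<subseteq> {a \<in> A. set a \<subseteq> M}. IP_set Gr S"
proof -
  interpret prime_ideal_group U M n Gr I
    by unfold_locales (fact assms)+
  have "{x \<in> G. x \<in> A} = A" using assms(10) by blast
  then have "IP_set Gr {x \<in> G. x \<in> A \<and> set x \<subseteq> M}"
    using assms(10-13)
    by (intro IP_set_exists[OF definable_over_dfn] non_product_free_realizations[of A]) auto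
  moreover have "{x \<in> G. x \<in> A \<and> set x \<subseteq> M} \<subseteq> {a \<in> A. set a \<subseteq> M}" by blast
  ultimately show ?thesis by blast
qed

end
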